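(* There exists an absolute constant $c$ such that the following holds. Let $d,n\in\mathbf N$, let $X,X_1,\ldots,X_n$ be i.i.d. real random variables with $p(1)=\mathbf P(|X_1-X_2|>1)>0$ (here $X_1,X_2$ are independent copies of $X$), let $a=(a_1,\ldots,a_n)\in(\mathbf R^d)^n$, $a\neq0$, and let $F_a^{(j)}$ be the distribution of the $j$-th coordinate of $S_a=\sum_{k=1}^nX_ka_k$. Let $A,B>0$. Let $\tau_j\ge\delta_j\ge0$, $\tau_j/\delta_j\le n^B$, and $q_j=Q(F_a^{(j)},\tau_j)\ge n^{-A}$ for $j=1,\ldots,d$. Then there exist numbers $r_1,\ldots,r_d\in\mathbf N$ and vectors $u^{(j)}=(u^{(j)}_1,\ldots,u^{(j)}_{r_j})\in\mathbf R^{r_j}$, $j=1,\ldots,d$, such that $$R=\sum_{j=1}^dr_j\le c\,d\,\bigl((A+B)\log n+1\bigr)$$ and $$p(1)\,M^*\Bigl\{\mathbf R^d\setminus\times_{j=1}^d[K_1(u^{(j)})]_{\delta_j}\Bigr\}\le c\,d\,\bigl((A+B)\log n+1\bigr)^3,$$ where $M^*=\sum_{k=1}^n(E_{a_k}+E_{-a_k})$. Moreover, the set $\times_{j=1}^dK_1(u^{(j)})$ can be represented as $K_1(u)$ with $u=(u_1,\ldots,u_R)\in(\mathbf R^d)^R$, where the vectors $u_s\in\mathbf R^d$, $s=1,\ldots,R$, have only one non-zero coordinate each: with $s_0=0$ and $s_k=\sum_{j=1}^kr_j$, $k=1,\ldots,d$, for $s_{k-1}<s\le s_k$ the vectors $u_s$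 are non-zero in the $k$-th coordinate only, and these $k$-th coordinates are equal to the sequence of coordinates $u^{(k)}_1,\ldots,u^{(k)}_{r_k}$ of the vector $u^{(k)}$ (i.e. the $k$-th coordinate of $u_s$ is $u^{(k)}_{s-s_{k-1}}$).
   Context: For a probability distribution $F=\mathcal L(Y)$ on $\mathbf R$ and $\lambda\ge0$, the concentration function is $Q(F,\lambda)=\sup_{x\in\mathbf R}\mathbf P(Y\in[x-\lambda/2,x+\lambda/2])$. $E_b$ is the probability distribution concentrated at the point $b$. $[B]_\delta$ denotes the closed $\delta$-neighborhood of a set $B\subset\mathbf R$, and $\times$ denotes the direct (Cartesian) product of sets. For $r\in\mathbf N$, a dimension $d'\ge1$ and $u=(u_1,\ldots,u_r)\in(\mathbf R^{d'})^r$, $$K_1(u)=\Bigl\{\sum_{j=1}^rn_ju_j:\ n_j\in\{-1,0,1\}\text{ for }j=1,\ldots,r\Bigr\}\subset\mathbf R^{d'}$$ (so $K_1(u^{(j)})\subset\mathbf R$, with $d'=1$). Convention: if $\tau_j=\delta_j=0$, then $\log(\tau_j/\delta_j)=0$, i.e. $\tau_j/\delta_j$ is read as $1$ and the condition $\tau_j/\delta_j\le n^B$ is satisfied; if $\tau_j>0=\delta_j$, then $\tau_j/\delta_j=+\infty$ and the condition fails. *)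

theory Defs
  imports "HOL-Probability.Probability"
begin

text \<open>
  Since the constant in the theorem is absolute, the dimensions and the number of summands have to
  be quantified inside the statement.  The space of real vectors of dimension \<open>d\<close> is therefore
  modelled by the extensional functions on \<open>{1..d}\<close>, and a Cartesian product of \<open>d\<close> sets of reals
  is \<open>PiE {1..d}\<close>.
\<close>

definition rvec :: "nat \<Rightarrow> (nat \<Rightarrow> real) set" where
  "rvec d = {1..d} \<rightarrow>\<^sub>E UNIV"

definition rvec_borel :: "nat \<Rightarrow> (nat \<Rightarrow> real) measure" where
  "rvec_borel d = PiM {1..d} (\<lambda>_. borel)"

definition rvec_uminus :: "nat \<Rightarrow> (nat \<Rightarrow> real) \<Rightarrow> nat \<Rightarrow> real" where
  "rvec_uminus d v = (\<lambda>j\<in>{1..d}. - v j)"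

definition concentration :: "real measure \<Rightarrow> real \<Rightarrow> real" where
  "concentration F l = (SUP x. measure F {x - l / 2 .. x + l / 2})"

text \<open>
  Everything depends on the random variables only through their common law \<open>\<mu>\<close>, so they are
  realised as the coordinates on the product space.  The lemmas at the end of the theory show that
  any other realisation gives the same quantities.
\<close>

definition iid_space :: "nat \<Rightarrow> real measure \<Rightarrow> (nat \<Rightarrow> real) measure" where
  "iid_space n \<mu> = PiM {1..n} (\<lambda>_. \<mu>)"

definition weighted_sum ::
    "nat \<Rightarrow> nat \<Rightarrow> (nat \<Rightarrow> nat \<Rightarrow> real) \<Rightarrow> (nat \<Rightarrow> real) \<Rightarrow> nat \<Rightarrow> real" where
  "weighted_sum d n a x = (\<lambda>j\<in>{1..d}. \<Sum>k=1..n. x k * a k j)"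

definition coord_law ::
    "nat \<Rightarrow> nat \<Rightarrow> real measure \<Rightarrow> (nat \<Rightarrow> nat \<Rightarrow> real) \<Rightarrow> nat \<Rightarrow> real measure" where
  "coord_law d n \<mu> a j = distr (iid_space n \<mu>) borel (\<lambda>x. weighted_sum d n a x j)"

definition sym_tail :: "real measure \<Rightarrow> real \<Rightarrow> real" where
  "sym_tail \<mu> t = measure (\<mu> \<Otimes>\<^sub>M \<mu>) {(x, y). \<bar>x - y\<bar> > t}"

text \<open>Only applied to non-empty sets; note that \<open>infdist x {} = 0\<close>.\<close>

definition closed_nbhd :: "real \<Rightarrow> real set \<Rightarrow> real set" where
  "closed_nbhd \<delta> B = {x. infdist x B \<le> \<delta>}"

text \<open>
  The set \<open>K\<^sub>1(u)\<close> for \<open>r\<close> vectors of dimension \<open>d\<close>, and for \<open>r\<close> real numbers as a set of reals.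
\<close>

definition K1 :: "nat \<Rightarrow> nat \<Rightarrow> (nat \<Rightarrow> nat \<Rightarrow> real) \<Rightarrow> (nat \<Rightarrow> real) set" where
  "K1 d r u = {(\<lambda>i\<in>{1..d}. \<Sum>j=1..r. of_int (m j) * u j i) | m :: nat \<Rightarrow> int.
                 \<forall>j\<in>{1..r}. m j \<in> {-1, 0, 1}}"

definition K1_real :: "nat \<Rightarrow> (nat \<Rightarrow> real) \<Rightarrow> real set" where
  "K1_real r u = {(\<Sum>j=1..r. of_int (m j) * u j) | m :: nat \<Rightarrow> int.
                    \<forall>j\<in>{1..r}. m j \<in> {-1, 0, 1}}"

text \<open>The value at \<open>C\<close> of the sum of the Dirac measures at the points \<open>a k\<close> and \<open>- a k\<close>.\<close>

definition M_star :: "nat \<Rightarrow> nat \<Rightarrow> (nat \<Rightarrow> nat \<Rightarrow> real) \<Rightarrow> (nat \<Rightarrow> real) set \<Rightarrow> real" where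
  "M_star d n a C = (\<Sum>k=1..n. measure (return (rvec_borel d) (a k)) C
                             + measure (return (rvec_borel d) (rvec_uminus d (a k))) C)"

text \<open>The quotient of non-negative reals with the conventions \<open>0/0 = 1\<close> and \<open>t/0 = \<infinity>\<close> for \<open>t > 0\<close>.\<close>

definition ext_ratio :: "real \<Rightarrow> real \<Rightarrow> ereal" where
  "ext_ratio t e = (if e = 0 then (if t = 0 then 1 else \<infinity>) else ereal (t / e))"

lemma coord_law_eq_distr:
  fixes X :: "nat \<Rightarrow> 'a \<Rightarrow> real"
  assumes "prob_space M" and n: "n \<ge> 1"
    and indep: "prob_space.indep_vars M (\<lambda>_. borel) X {1..n}"
    and law: "\<And>k. k \<in> {1..n} \<Longrightarrow> distr M borel (X k) = \<mu>"
    and j: "j \<in> {1..d}"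
  shows "coord_law d n \<mu> a j = distr M borel (\<lambda>w. \<Sum>k=1..n. X k w * a k j)"
proof -
  interpret prob_space M by fact
  have rv: "X k \<in> borel_measurable M" if "k \<in> {1..n}" for k
    using indep that by (auto simp: indep_vars_def)
  have sets: "sets \<mu> = sets borel"
    using law[of 1] n by (metis atLeastAtMost_iff order_refl sets_distr)
  have "iid_space n \<mu> = PiM {1..n} (\<lambda>k. distr M borel (X k))"
    unfolding iid_space_def by (intro PiM_cong) (auto simp: law)
  also have "\<dots> = distr M (PiM {1..n} (\<lambda>_. borel)) (\<lambda>w. \<lambda>k\<in>{1..n}. X k w)"
    using indep n rv by (subst (asm) indep_vars_iff_distr_eq_PiM') (auto)
  finally have iid: "iid_space n \<mu> = \<dots>" .
  have meas: "(\<lambda>x. \<Sum>k=1..n. x k * a k j) \<in> borel_measurable (PiM {1..n} (\<lambda>_. borel))"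
    by (intro borel_measurable_sum borel_measurable_times) auto
  have "coord_law d n \<mu> a j = distr (iid_space n \<mu>) borel (\<lambda>x. \<Sum>k=1..n. x k * a k j)"
    using j by (simp add: coord_law_def weighted_sum_def)
  also have "\<dots> = distr M borel ((\<lambda>x. \<Sum>k=1..n. x k * a k j) \<circ> (\<lambda>w. \<lambda>k\<in>{1..n}. X k w))"
    unfolding iid by (intro distr_distr meas) (auto intro!: measurable_restrict rv)
  also have "\<dots> = distr M borel (\<lambda>w. \<Sum>k=1..n. X k w * a k j)"
    by (rule distr_cong) (auto intro!: sum.cong)
  finally show ?thesis .
qed

lemma sym_tail_eq_prob:
  fixes X Y :: "'a \<Rightarrow> real"
  assumes "prob_space M" and indep: "prob_space.indep_var M borel X borel Y"
    and X: "distr M borel X = \<mu>" and Y: "distr M borel Y = \<mu>"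
  shows "sym_tail \<mu> t = measure M {w \<in> space M. \<bar>X w - Y w\<bar> > t}"
proof -
  interpret prob_space M by fact
  have rv: "X \<in> borel_measurable M" "Y \<in> borel_measurable M"
    using indep by (auto simp: indep_var_distribution_eq)
  have eq: "\<mu> \<Otimes>\<^sub>M \<mu> = distr M (borel \<Otimes>\<^sub>M borel) (\<lambda>w. (X w, Y w))"
    using indep X Y by (simp add: indep_var_distribution_eq)
  have m: "{(x, y). \<bar>x - y\<bar> > t} \<in> sets (borel \<Otimes>\<^sub>M borel :: (real \<times> real) measure)"
    unfolding borel_prod case_prod_unfold
    by (intro borel_open open_Collect_less continuous_intros)
  show ?thesis
    unfolding sym_tail_def eq
    by (subst measure_distr) (use rv m in \<open>auto intro!: arg_cong[where f = "measure M"]\<close>)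
qed

end

theory Submission
  imports Defs
begin

text \<open>
  Everything happens in one coordinate at a time; the coordinates are put together at the end by a
  union bound.  So let \<open>a\<^sub>1, \<dots>, a\<^sub>n\<close> be reals, \<open>S = \<Sum> X\<^sub>k a\<^sub>k\<close>, \<open>p = p(1)\<close> and
  \<open>L = (A + B) log n + 1\<close>.

  Choose generators among the \<open>a\<^sub>k\<close> greedily, each at a distance greater than \<open>\<delta>\<close> from the set
  \<open>K\<^sub>1\<close> of the earlier ones.  If the choice stops after few steps, all \<open>a\<^sub>k\<close> are within \<open>\<delta>\<close> of \<open>K\<^sub>1\<close>
  of the chosen ones.  Otherwise there is a \<^emph>\<open>dissociated\<close> block of length \<open>r\<close>, whose \<open>2\<^sup>r\<close> subset
  sums are more than \<open>\<delta>\<close> apart.  Removing it and starting again, one finds either \<open>m\<close> disjoint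
  dissociated blocks of length \<open>r\<close>, or at most \<open>r\<close> generators which leave out at most \<open>m r\<close> of the
  \<open>a\<^sub>k\<close> (\<open>many_blocks_or_few_exceptions\<close>).

  It remains to see that \<open>m \<approx> 2 / p\<close> blocks of length \<open>r \<approx> 16 L\<close> contradict
  \<open>Q(S, \<tau>) \<ge> n\<^sup>-\<^sup>A\<close> (\<open>concentration_le_of_dissociated_blocks\<close>).  By Gaussian smoothing,
  \<open>Q(S, \<tau>)\<close> is at most a constant times the mean of \<open>\<bar>E exp (i t S)\<bar>\<close> over \<open>t = g / \<tau>\<close>, with
  \<open>g\<close> standard normal.  Symmetrization bounds the integrand by
  \<open>exp (- E \<Sum> (1 - cos (t a\<^sub>k D)) / 2)\<close> with \<open>D = X\<^sub>1 - X\<^sub>2\<close>.  Jensen's inequality, applied to the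
  condition \<open>\<bar>D\<bar> > 1\<close> and to the choice of a block, replaces this by an average, over values
  \<open>\<bar>D\<bar> > 1\<close> and over blocks, of \<open>exp (- (p m / 2) \<Sum> (1 - cos (t a\<^sub>k D)))\<close> with \<open>k\<close> running over one
  block only.  As \<open>p m \<ge> 2\<close>, each factor is at most
  \<open>\<bar>3 / 4 + exp (i t a\<^sub>k D) / 4\<bar>\<^sup>2\<close>.  The product of these factors belongs to the symmetrization of a
  random subset sum of the block, scaled by \<open>D\<close>.  The subset sums are separated, and none of them
  has probability above \<open>(3 / 4)\<^sup>r\<close>, so the Gaussian mean is at most \<open>8 (\<tau> / \<delta>) (3 / 4)\<^sup>r\<close>
  (\<open>integral_dissociated_prod_le\<close>), which is too small as \<open>\<tau> / \<delta> \<le> n\<^sup>B\<close>.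

  Summed over the coordinates, \<open>p\<close> times the exceptional mass comes out as at most a multiple of
  \<open>d L\<close>, hence of \<open>d L\<^sup>3\<close> since \<open>L \<ge> 1\<close>.
\<close>

section \<open>Dissociated lists\<close>

text \<open>
  The set \<open>K\<^sub>1\<close> of a list of reals.  The recursion on the list matches the greedy choice of
  generators, which puts every new generator at the head.
\<close>

primrec cube :: "real list \<Rightarrow> real set" where
  "cube [] = {0}"
| "cube (u # us) = (\<Union>c\<in>{-1, 0, 1}. (\<lambda>y. c * u + y) ` cube us)"

text \<open>
  A witness replaces the distance to the cube: the cube is finite, so the infimum is attained.
\<close>

definition near_cube :: "real \<Rightarrow> real list \<Rightarrow> real \<Rightarrow> bool" where
  "near_cube \<delta> us x \<longleftrightarrow> (\<exists>y\<in>cube us. \<bar>x - y\<bar> \<le> \<delta>)"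

text \<open>
  A generator far from the cube of the generators after it cannot be compensated by them, whatever
  signs they carry.  For a difference of two subset sums, the first generator at which the
  subsets differ plays this part, so distinct subsets have sums more than \<open>\<delta>\<close> apart.
\<close>

primrec dissociated :: "real \<Rightarrow> real list \<Rightarrow> bool" where
  "dissociated \<delta> [] \<longleftrightarrow> True"
| "dissociated \<delta> (u # us) \<longleftrightarrow> \<not> near_cube \<delta> us u \<and> dissociated \<delta> us"

lemma finite_cube: "finite (cube us)"
  by (induction us) auto

lemma zero_in_cube: "0 \<in> cube us"
  by (induction us) (auto simp: image_iff)

lemma cube_Cons_tail: "x \<in> cube us \<Longrightarrow> x \<in> cube (u # us)"
  by auto

lemma member_in_cube: "u \<in> set us \<Longrightarrow> u \<in> cube us"
proof (induction us)
  case (Cons v us)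
  show ?case
  proof (cases "u = v")
    case True
    have "1 * v + 0 \<in> cube (v # us)"
      using zero_in_cube[of us] unfolding cube.simps by blast
    with True show ?thesis by simp
  next
    case False
    with Cons show ?thesis by (auto intro: cube_Cons_tail)
  qed
qed simp

lemma uminus_in_cube: "x \<in> cube us \<Longrightarrow> - x \<in> cube us"
proof (induction us arbitrary: x)
  case (Cons u us)
  then obtain c y where cy: "c \<in> {-1, 0, 1}" "y \<in> cube us" "x = c * u + y"
    unfolding cube.simps by blast
  have "(- c) * u + (- y) \<in> cube (u # us)"
    using cy(1) Cons.IH[OF cy(2)] unfolding cube.simps
    by (intro UN_I[of "- c"] imageI) auto
  with cy(3) show ?case by simp
qed simp

lemma not_near_cube_iff: "\<not> near_cube \<delta> us x \<longleftrightarrow> (\<forall>y\<in>cube us. \<delta> < \<bar>x - y\<bar>)"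
  by (auto simp: near_cube_def not_le)

lemma near_cube_member: "\<delta> \<ge> 0 \<Longrightarrow> u \<in> set us \<Longrightarrow> near_cube \<delta> us u"
  using member_in_cube[of u us] by (auto simp: near_cube_def intro!: bexI[of _ u])

lemma dissociated_nonzero:
  assumes "\<delta> \<ge> 0"
  shows "dissociated \<delta> us \<Longrightarrow> 0 \<notin> set us"
proof (induction us)
  case (Cons u us)
  then show ?case
    using assms zero_in_cube[of us] by (auto simp: near_cube_def)
qed simp

lemma dissociated_antimono: "\<epsilon> \<le> \<delta> \<Longrightarrow> dissociated \<delta> us \<Longrightarrow> dissociated \<epsilon> us"
  by (induction us) (auto simp: near_cube_def)

text \<open>
  In the case \<open>\<tau> = \<delta> = 0\<close> the Gaussian estimates below have no scale to work with.  A cube is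
  finite, so positive distances to it have a positive minimum, which serves as a scale.
\<close>

lemma dissociated_zero_imp_pos: "dissociated 0 us \<Longrightarrow> \<exists>\<delta>>0. dissociated \<delta> us"
proof (induction us)
  case Nil
  show ?case by (auto intro: exI[of _ 1])
next
  case (Cons u us)
  then obtain \<delta> where \<delta>: "\<delta> > 0" "dissociated \<delta> us" by auto
  define \<eta> where "\<eta> = Min ((\<lambda>y. \<bar>u - y\<bar>) ` cube us)"
  have ne: "cube us \<noteq> {}" using zero_in_cube[of us] by auto
  have "\<eta> \<in> (\<lambda>y. \<bar>u - y\<bar>) ` cube us"
    unfolding \<eta>_def using ne finite_cube by (intro Min_in) auto
  with Cons.prems have pos: "\<eta> > 0"
    by (auto simp: not_near_cube_iff)
  have le: "\<eta> \<le> \<bar>u - y\<bar>" if "y \<in> cube us" for y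
    unfolding \<eta>_def using that finite_cube by (intro Min_le) auto
  define \<epsilon> where "\<epsilon> = min \<delta> (\<eta> / 2)"
  have "\<epsilon> > 0" "\<epsilon> \<le> \<delta>" "\<epsilon> < \<eta>" using \<delta> pos by (auto simp: \<epsilon>_def min_def)
  then show ?case
    using \<delta>(2) le dissociated_antimono[of \<epsilon> \<delta> us]
    by (intro exI[of _ \<epsilon>]) (fastforce simp: not_near_cube_iff)
qed

lemma dissociated_zero_imp_pos_family:
  assumes "finite F" and "\<And>us. us \<in> F \<Longrightarrow> dissociated 0 us"
  shows "\<exists>\<delta>>0. \<forall>us\<in>F. dissociated \<delta> us"
  using assms
proof (induction F rule: finite_induct)
  case empty
  show ?case by (auto intro: exI[of _ 1])
next
  case (insert us F)
  then obtain \<delta> where \<delta>: "\<delta> > 0" "\<forall>us\<in>F. dissociated \<delta> us" by auto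
  obtain \<epsilon> where \<epsilon>: "\<epsilon> > 0" "dissociated \<epsilon> us"
    using dissociated_zero_imp_pos insert.prems by blast
  show ?case
    using \<delta> \<epsilon> by (intro exI[of _ "min \<delta> \<epsilon>"])
      (auto intro: dissociated_antimono[of "min \<delta> \<epsilon>" \<delta>] dissociated_antimono[of "min \<delta> \<epsilon>" \<epsilon>])
qed

text \<open>
  Indices whose entries are far from the current cube are put at the head of the list, until
  \<open>r\<close> of them have been chosen or no such index is left.
\<close>

lemma greedy_dissociated_list:
  fixes a :: "'i \<Rightarrow> real"
  assumes "\<delta> \<ge> 0"
  shows "\<exists>ks. set ks \<subseteq> I \<and> distinct ks \<and> dissociated \<delta> (map a ks) \<and> length ks \<le> r \<and>
           (length ks = r \<or> (\<forall>k\<in>I. near_cube \<delta> (map a ks) (a k)))"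
proof (induction r)
  case 0
  show ?case by (intro exI[of _ "[]"]) auto
next
  case (Suc r)
  then obtain ks where ks: "set ks \<subseteq> I" "distinct ks" "dissociated \<delta> (map a ks)" "length ks \<le> r"
      "length ks = r \<or> (\<forall>k\<in>I. near_cube \<delta> (map a ks) (a k))"
    by auto
  show ?case
  proof (cases "\<forall>k\<in>I. near_cube \<delta> (map a ks) (a k)")
    case True
    with ks show ?thesis by (intro exI[of _ ks]) auto
  next
    case False
    then obtain k where k: "k \<in> I" "\<not> near_cube \<delta> (map a ks) (a k)" by auto
    have "k \<notin> set ks"
      using k near_cube_member[of \<delta> "a k" "map a ks"] assms by auto
    with k ks False show ?thesis by (intro exI[of _ "k # ks"]) auto
  qed
qed

text \<open>
  The greedy choice is repeated on the indices that no earlier block has used.  If a choice stops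
  short of \<open>r\<close> generators, these generators cover everything outside the earlier blocks, and at
  most \<open>m\<close> blocks of length \<open>r\<close> were chosen before.
\<close>

lemma many_blocks_or_few_exceptions:
  fixes a :: "'i \<Rightarrow> real"
  assumes "\<delta> \<ge> 0" "finite I"
  shows "(\<exists>bs. length bs = m \<and> distinct (concat bs) \<and> set (concat bs) \<subseteq> I \<and>
            (\<forall>ks\<in>set bs. length ks = r \<and> dissociated \<delta> (map a ks))) \<or>
         (\<exists>us. length us \<le> r \<and> 0 \<notin> set us \<and> card {k \<in> I. \<not> near_cube \<delta> us (a k)} \<le> m * r)"
proof (induction m)
  case 0
  show ?case by (intro disjI1 exI[of _ "[]"]) auto
next
  case (Suc m)
  then consider
    (blocks) bs where "length bs = m" "distinct (concat bs)" "set (concat bs) \<subseteq> I"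
      "\<forall>ks\<in>set bs. length ks = r \<and> dissociated \<delta> (map a ks)"
  | (few) us where "length us \<le> r" "0 \<notin> set us" "card {k \<in> I. \<not> near_cube \<delta> us (a k)} \<le> m * r"
    by blast
  then show ?case
  proof cases
    case few
    then show ?thesis by (intro disjI2 exI[of _ us]) auto
  next
    case blocks
    obtain ks where ks: "set ks \<subseteq> I - set (concat bs)" "distinct ks" "dissociated \<delta> (map a ks)"
      "length ks \<le> r" "length ks = r \<or> (\<forall>k\<in>I - set (concat bs). near_cube \<delta> (map a ks) (a k))"
      using greedy_dissociated_list[OF assms(1), of "I - set (concat bs)" a r] by blast
    show ?thesis
    proof (cases "length ks = r")
      case True
      have "distinct (concat (ks # bs))" "set (concat (ks # bs)) \<subseteq> I"
        using blocks ks by auto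
      with True blocks ks show ?thesis by (intro disjI1 exI[of _ "ks # bs"]) auto
    next
      case False
      with ks have "{k \<in> I. \<not> near_cube \<delta> (map a ks) (a k)} \<subseteq> set (concat bs)" by auto
      then have "card {k \<in> I. \<not> near_cube \<delta> (map a ks) (a k)} \<le> card (set (concat bs))"
        by (intro card_mono) auto
      also have "\<dots> \<le> length (concat bs)" by (rule card_length)
      also have "\<dots> = (\<Sum>ks\<leftarrow>bs. r)"
        using blocks by (auto simp: length_concat intro!: arg_cong[where f = sum_list])
      also have "\<dots> = m * r" using blocks by (simp add: sum_list_triv)
      finally have "card {k \<in> I. \<not> near_cube \<delta> (map a ks) (a k)} \<le> Suc m * r" by simp
      moreover have "0 \<notin> set (map a ks)"
        using dissociated_nonzero[OF assms(1) ks(3)] .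
      ultimately show ?thesis
        using ks by (intro disjI2 exI[of _ "map a ks"]) auto
    qed
  qed
qed

section \<open>The subset sums of a dissociated list\<close>

text \<open>
  The characteristic function of \<open>\<epsilon> - \<epsilon>'\<close> for independent \<open>\<epsilon>\<close>, \<open>\<epsilon>'\<close> with value \<open>1\<close> of
  probability \<open>1 / 4\<close> and value \<open>0\<close> otherwise.  Probability \<open>1 / 2\<close> would not do: the function
  would vanish at \<open>\<pi>\<close> and could not dominate an exponential there.
\<close>

definition bern_diff_char :: "real \<Rightarrow> real" where
  "bern_diff_char x = 1 - 3 / 8 * (1 - cos x)"

lemma bern_diff_char_eq_norm: "bern_diff_char x = (cmod (3 / 4 + 1 / 4 * cis x))\<^sup>2"
proof -
  have "(cmod (3 / 4 + 1 / 4 * cis x))\<^sup>2 = (3 / 4 + cos x / 4)\<^sup>2 + (sin x / 4)\<^sup>2"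
    by (simp add: cmod_power2)
  also have "\<dots> = 9 / 16 + 3 / 8 * cos x + ((cos x)\<^sup>2 + (sin x)\<^sup>2) / 16"
    by (simp only: power2_sum power_divide) (simp add: add_divide_distrib del: sin_cos_squared_add2)
  also have "\<dots> = bern_diff_char x"
    by (simp only: sin_cos_squared_add2 bern_diff_char_def) (simp add: field_simps)
  finally show ?thesis ..
qed

text \<open>
  In the variable \<open>1 - cos x \<in> [0, 2]\<close> the left-hand side is convex and the right-hand side is
  affine, so only the end points matter; at \<open>2\<close> the values are at most \<open>exp (-2)\<close> and exactly
  \<open>1 / 4\<close>.
\<close>

lemma exp_le_bern_diff_char:
  assumes "s \<ge> 1"
  shows "exp (- s * (1 - cos x)) \<le> bern_diff_char x"
proof -
  define v where "v = (1 - cos x) / 2"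
  have v: "0 \<le> v" "v \<le> 1" using cos_le_one[of x] cos_ge_minus_one[of x] by (auto simp: v_def)
  have "exp (- s * (1 - cos x)) \<le> exp ((1 - v) * 0 + v * (-2))"
    using assms v mult_right_mono[of 1 s v] by (simp add: v_def field_simps)
  also have "\<dots> \<le> (1 - v) * exp 0 + v * exp (-2)"
    using convex_onD[OF exp_convex, of v 0 "-2 :: real"] v by (simp add: algebra_simps)
  also have "exp (-2::real) \<le> 1 / 4"
  proof -
    have "exp (2::real) = exp 1 * exp 1" by (simp flip: exp_add)
    also have "\<dots> \<ge> 2 * 2"
      using exp_ge_add_one_self[of "1::real"] by (intro mult_mono) auto
    finally show ?thesis by (simp add: exp_minus field_simps)
  qed
  then have "(1 - v) * exp 0 + v * exp (-2) \<le> (1 - v) * 1 + v * (1 / 4)"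
    using v by (intro add_mono mult_left_mono) auto
  also have "\<dots> = bern_diff_char x" by (simp add: bern_diff_char_def v_def field_simps)
  finally show ?thesis by simp
qed

text \<open>
  The product is the characteristic function of \<open>\<Sum> \<epsilon>\<^sub>u u\<close> with independent \<open>\<epsilon>\<^sub>u\<close> as above, so \<open>V\<close> is
  the set of subset sums and \<open>w\<close> the law on it.  Dissociativity keeps the subset sums distinct:
  no point gets more than the mass of the most likely choice of all \<open>\<epsilon>\<^sub>u\<close>, which is
  \<open>(3 / 4) ^ r\<close>.  The clause on differences is what the induction uses to separate the
  translate of \<open>V\<close> by a new generator from \<open>V\<close>.
\<close>

lemma dissociated_prod_expansion:
  assumes "\<delta> \<ge> 0"
  shows "dissociated \<delta> us \<Longrightarrow>
    \<exists>V w. finite V \<and> (\<forall>x\<in>V. \<forall>y\<in>V. x - y \<in> cube us) \<and>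
      (\<forall>x\<in>V. \<forall>y\<in>V. x \<noteq> y \<longrightarrow> \<delta> < \<bar>x - y\<bar>) \<and>
      (\<forall>v\<in>V. 0 \<le> w v \<and> w v \<le> (3 / 4) ^ length us) \<and> sum w V = 1 \<and>
      (\<forall>x. (\<Prod>u\<leftarrow>us. 3 / 4 + 1 / 4 * cis (u * x)) = (\<Sum>v\<in>V. of_real (w v) * cis (v * x)))"
proof (induction us)
  case Nil
  show ?case by (intro exI[of _ "{0}"] exI[of _ "\<lambda>_. 1"]) auto
next
  case (Cons u us)
  then obtain V w where fin: "finite V" and diff: "\<And>x y. x \<in> V \<Longrightarrow> y \<in> V \<Longrightarrow> x - y \<in> cube us"
    and sep: "\<And>x y. x \<in> V \<Longrightarrow> y \<in> V \<Longrightarrow> x \<noteq> y \<Longrightarrow> \<delta> < \<bar>x - y\<bar>"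
    and w: "\<And>v. v \<in> V \<Longrightarrow> 0 \<le> w v \<and> w v \<le> (3 / 4) ^ length us" "sum w V = 1"
    and eq: "\<And>x. (\<Prod>u\<leftarrow>us. 3 / 4 + 1 / 4 * cis (u * x)) = (\<Sum>v\<in>V. of_real (w v) * cis (v * x))"
    by auto metis
  have far: "\<delta> < \<bar>u - y\<bar>" if "y \<in> cube us" for y
    using Cons.prems that by (auto simp: not_near_cube_iff)
  define V' where "V' = V \<union> (+) u ` V"
  define w' where "w' v = (if v \<in> V then 3 / 4 * w v else 1 / 4 * w (v - u))" for v
  have cross: "\<delta> < \<bar>(u + x) - y\<bar>" if "x \<in> V" "y \<in> V" for x y
    using far[OF diff[OF that(2,1)]] by (simp add: algebra_simps)
  have disj: "V \<inter> (+) u ` V = {}"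
    using cross assms by fastforce
  have sum': "(\<Sum>v\<in>V'. g v (w' v)) = (\<Sum>v\<in>V. g v (3 / 4 * w v)) + (\<Sum>v\<in>V. g (u + v) (1 / 4 * w v))"
    for g :: "real \<Rightarrow> real \<Rightarrow> 'a::comm_monoid_add"
  proof -
    have "(\<Sum>v\<in>V'. g v (w' v)) = (\<Sum>v\<in>V. g v (w' v)) + (\<Sum>v\<in>(+) u ` V. g v (w' v))"
      unfolding V'_def using fin disj by (intro sum.union_disjoint) auto
    also have "(\<Sum>v\<in>V. g v (w' v)) = (\<Sum>v\<in>V. g v (3 / 4 * w v))"
      by (intro sum.cong) (auto simp: w'_def)
    also have "(\<Sum>v\<in>(+) u ` V. g v (w' v)) = (\<Sum>v\<in>V. g (u + v) (1 / 4 * w v))"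
    proof (subst sum.reindex)
      show "inj_on ((+) u) V" by auto
      show "sum ((\<lambda>v. g v (w' v)) \<circ> (+) u) V = (\<Sum>v\<in>V. g (u + v) (1 / 4 * w v))"
        using disj by (intro sum.cong) (auto simp: w'_def disjoint_iff)
    qed
    finally show ?thesis .
  qed
  have "finite V'" using fin by (simp add: V'_def)
  moreover have "x - y \<in> cube (u # us)" if "x \<in> V'" "y \<in> V'" for x y
  proof -
    obtain b x' where x: "b \<in> {0, 1}" "x' \<in> V" "x = b * u + x'"
      using \<open>x \<in> V'\<close> unfolding V'_def by force
    obtain c y' where y: "c \<in> {0, 1}" "y' \<in> V" "y = c * u + y'"
      using \<open>y \<in> V'\<close> unfolding V'_def by force
    have "(b - c) * u + (x' - y') \<in> cube (u # us)"
      unfolding cube.simps using x y diff by (intro UN_I[of "b - c"] imageI) auto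
    then show ?thesis by (simp add: x y algebra_simps)
  qed
  moreover have "\<delta> < \<bar>x - y\<bar>" if "x \<in> V'" "y \<in> V'" "x \<noteq> y" for x y
    using that sep cross unfolding V'_def
    by (auto simp: abs_minus_commute)
  moreover have "0 \<le> w' v \<and> w' v \<le> (3 / 4) ^ length (u # us)" if "v \<in> V'" for v
  proof (cases "v \<in> V")
    case True
    with w show ?thesis by (auto simp: w'_def)
  next
    case False
    with that have "v - u \<in> V" by (auto simp: V'_def)
    from w(1)[OF this] False show ?thesis by (auto simp: w'_def)
  qed
  moreover have "sum w' V' = 1"
    using sum'[of "\<lambda>_ x. x"] w(2)
    by (simp only: sum_distrib_left[symmetric] mult_1_right)
  moreover have "(\<Prod>u\<leftarrow>u # us. 3 / 4 + 1 / 4 * cis (u * x)) = (\<Sum>v\<in>V'. of_real (w' v) * cis (v * x))" for x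
  proof -
    have "(\<Prod>u\<leftarrow>u # us. 3 / 4 + 1 / 4 * cis (u * x)) =
        (3 / 4 + 1 / 4 * cis (u * x)) * (\<Sum>v\<in>V. of_real (w v) * cis (v * x))"
      using eq[of x] by simp
    also have "\<dots> = (\<Sum>v\<in>V. of_real (3 / 4 * w v) * cis (v * x)) +
        (\<Sum>v\<in>V. of_real (1 / 4 * w v) * cis ((u + v) * x))"
      unfolding distrib_right sum_distrib_left sum.distrib[symmetric]
      by (intro sum.cong refl) (simp add: cis_mult[symmetric] mult_ac)
    finally show ?thesis
      unfolding sum'[of "\<lambda>v t. of_real t * cis (v * x)"] .
  qed
  ultimately show ?case
    by (intro exI[of _ V'] exI[of _ w']) blast
qed

text \<open>
  The squared modulus of the expansion above, that is, the symmetrization of the law \<open>w\<close>.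
\<close>

lemma prod_bern_diff_char_expansion:
  assumes "\<delta> \<ge> 0" "dissociated \<delta> us"
  obtains V :: "real set" and w where "finite V"
    "\<And>x y. x \<in> V \<Longrightarrow> y \<in> V \<Longrightarrow> x \<noteq> y \<Longrightarrow> \<delta> < \<bar>x - y\<bar>"
    "\<And>v. v \<in> V \<Longrightarrow> 0 \<le> w v" "\<And>v. v \<in> V \<Longrightarrow> w v \<le> (3 / 4) ^ length us" "sum w V = 1"
    "\<And>x. (\<Prod>u\<leftarrow>us. bern_diff_char (u * x)) = (\<Sum>v\<in>V. \<Sum>v'\<in>V. w v * w v' * cos ((v - v') * x))"
proof -
  obtain V w where V: "finite V" "\<forall>x\<in>V. \<forall>y\<in>V. x \<noteq> y \<longrightarrow> \<delta> < \<bar>x - y\<bar>"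
    "\<forall>v\<in>V. 0 \<le> w v \<and> w v \<le> (3 / 4) ^ length us" "sum w V = 1"
    and eq: "\<And>x. (\<Prod>u\<leftarrow>us. 3 / 4 + 1 / 4 * cis (u * x)) = (\<Sum>v\<in>V. of_real (w v) * cis (v * x))"
    using dissociated_prod_expansion[OF assms] by metis
  have "(\<Prod>u\<leftarrow>us. bern_diff_char (u * x)) = (\<Sum>v\<in>V. \<Sum>v'\<in>V. w v * w v' * cos ((v - v') * x))" for x
  proof -
    have "(\<Prod>u\<leftarrow>us. bern_diff_char (u * x)) = (cmod (\<Prod>u\<leftarrow>us. 3 / 4 + 1 / 4 * cis (u * x)))\<^sup>2"
      by (induction us) (simp_all add: bern_diff_char_eq_norm norm_mult power_mult_distrib)
    also have "\<dots> = (\<Sum>v\<in>V. w v * cos (v * x))\<^sup>2 + (\<Sum>v\<in>V. w v * sin (v * x))\<^sup>2"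
      unfolding eq cmod_power2 by simp
    also have "\<dots> = (\<Sum>v\<in>V. \<Sum>v'\<in>V. w v * w v' * cos ((v - v') * x))"
      unfolding power2_eq_square sum_product sum.distrib[symmetric]
      by (intro sum.cong refl) (simp add: left_diff_distrib cos_diff algebra_simps)
    finally show ?thesis .
  qed
  with V show ?thesis by (intro that[of V w]) auto
qed

section \<open>Gaussian sums over separated sets\<close>

text \<open>
  Each interval \<open>[k \<delta>, (k + 1) \<delta>)\<close> contains at most one point of \<open>V\<close>, so a geometric series with
  ratio \<open>exp (- \<delta> / \<tau>)\<close> dominates the sum.
\<close>

lemma separated_exp_sum_one_sided:
  fixes V :: "real set"
  assumes "finite V" "\<And>v. v \<in> V \<Longrightarrow> v \<ge> 0" "0 < \<delta>" "\<delta> \<le> \<tau>"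
    and sep: "\<And>x y. x \<in> V \<Longrightarrow> y \<in> V \<Longrightarrow> x \<noteq> y \<Longrightarrow> \<delta> < \<bar>x - y\<bar>"
  shows "(\<Sum>v\<in>V. exp (- v / \<tau>)) \<le> 2 * \<tau> / \<delta>"
proof -
  define \<rho> where "\<rho> = \<delta> / \<tau>"
  have \<rho>: "0 < \<rho>" "\<rho> \<le> 1" using assms by (auto simp: \<rho>_def)
  define K where "K v = nat \<lfloor>v / \<delta>\<rfloor>" for v
  have K: "real (K v) \<le> v / \<delta>" "v / \<delta> < real (K v) + 1" if "v \<in> V" for v
    using assms(2)[OF that] \<open>0 < \<delta>\<close> floor_correct[of "v / \<delta>"] by (simp_all add: K_def)
  have inj: "inj_on K V"
  proof (rule inj_onI, rule ccontr)
    fix x y assume xy: "x \<in> V" "y \<in> V" "K x = K y" "x \<noteq> y"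
    then have "\<bar>x / \<delta> - y / \<delta>\<bar> < 1" using K[of x] K[of y] by simp
    then have "\<bar>x - y\<bar> / \<delta> < 1"
      using \<open>0 < \<delta>\<close> by (simp add: diff_divide_distrib[symmetric])
    then have "\<bar>x - y\<bar> < \<delta>" using \<open>0 < \<delta>\<close> by simp
    with sep[OF xy(1,2,4)] show False by simp
  qed
  define q where "q = exp (- \<rho>)"
  have q: "0 < q" "q < 1" using \<rho> by (auto simp: q_def)
  have "1 + \<rho> \<le> exp \<rho>" by (rule exp_ge_add_one_self)
  then have "q \<le> 1 / (1 + \<rho>)" using \<rho> by (simp add: q_def exp_minus field_simps)
  also have "\<dots> \<le> 1 - \<rho> / 2"
  proof -
    have "(1 - \<rho> / 2) * (1 + \<rho>) = 1 + \<rho> * (1 - \<rho>) / 2" by (simp add: field_simps)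
    moreover have "\<rho> * (1 - \<rho>) \<ge> 0" using \<rho> by simp
    ultimately have "1 \<le> (1 - \<rho> / 2) * (1 + \<rho>)" by simp
    then show ?thesis using \<rho> by (subst pos_divide_le_eq) auto
  qed
  finally have q_le: "q \<le> 1 - \<rho> / 2" .
  have "(\<Sum>v\<in>V. exp (- v / \<tau>)) \<le> (\<Sum>v\<in>V. q ^ K v)"
  proof (intro sum_mono)
    fix v assume "v \<in> V"
    have "real (K v) * \<rho> \<le> v / \<delta> * \<rho>" using K[OF \<open>v \<in> V\<close>] \<rho> by (intro mult_right_mono) auto
    also have "\<dots> = v / \<tau>" using assms by (simp add: \<rho>_def)
    finally show "exp (- v / \<tau>) \<le> q ^ K v"
      by (simp add: q_def flip: exp_of_nat_mult)
  qed
  also have "\<dots> = (\<Sum>k\<in>K ` V. q ^ k)" using inj by (simp add: sum.reindex)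
  also have "\<dots> \<le> (\<Sum>k. q ^ k)"
    using q assms(1) by (intro sum_le_suminf summable_geometric) auto
  also have "\<dots> = 1 / (1 - q)" using q by (intro suminf_geometric) auto
  also have "\<dots> \<le> 1 / (\<rho> / 2)" using q_le \<rho> q by (intro divide_left_mono mult_pos_pos) auto
  also have "\<dots> = 2 * \<tau> / \<delta>" by (simp add: \<rho>_def)
  finally show ?thesis .
qed

text \<open>
  The Gaussian is at most \<open>2 exp (- \<bar>t\<bar>)\<close>, and the points on each side of the centre \<open>c\<close> are
  handled by the one-sided bound.
\<close>

lemma separated_gaussian_sum:
  fixes V :: "real set"
  assumes "finite V" "0 < \<delta>" "\<delta> \<le> \<tau>"
    and sep: "\<And>x y. x \<in> V \<Longrightarrow> y \<in> V \<Longrightarrow> x \<noteq> y \<Longrightarrow> \<delta> < \<bar>x - y\<bar>"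
  shows "(\<Sum>v\<in>V. exp (- ((v - c) / \<tau>)\<^sup>2 / 2)) \<le> 8 * \<tau> / \<delta>"
proof -
  define R where "R = {v \<in> V. c \<le> v}"
  define L where "L = {v \<in> V. v < c}"
  have half: "exp (1 / 2 :: real) \<le> 2"
  proof -
    have "(exp (1 / 2 :: real))\<^sup>2 = exp 1" by (simp add: power2_eq_square flip: exp_add)
    also have "\<dots> \<le> 2\<^sup>2" using exp_le by simp
    finally show ?thesis by (rule power2_le_imp_le) simp
  qed
  have pt: "exp (- t\<^sup>2 / 2) \<le> 2 * exp (- \<bar>t\<bar>)" for t :: real
  proof -
    have "0 \<le> (\<bar>t\<bar> - 1)\<^sup>2" by simp
    then have "- t\<^sup>2 / 2 \<le> 1 / 2 + (- \<bar>t\<bar>)" by (simp add: power2_diff)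
    then have "exp (- t\<^sup>2 / 2) \<le> exp (1 / 2) * exp (- \<bar>t\<bar>)" by (simp flip: exp_add)
    also have "\<dots> \<le> 2 * exp (- \<bar>t\<bar>)" using half by (intro mult_right_mono) auto
    finally show ?thesis .
  qed
  have "(\<Sum>v\<in>V. exp (- ((v - c) / \<tau>)\<^sup>2 / 2)) \<le> (\<Sum>v\<in>V. 2 * exp (- \<bar>(v - c) / \<tau>\<bar>))"
    by (intro sum_mono pt)
  also have "\<dots> = 2 * (\<Sum>v\<in>V. exp (- \<bar>(v - c) / \<tau>\<bar>))" by (simp add: sum_distrib_left)
  also have "(\<Sum>v\<in>V. exp (- \<bar>(v - c) / \<tau>\<bar>)) =
      (\<Sum>v\<in>R. exp (- \<bar>(v - c) / \<tau>\<bar>)) + (\<Sum>v\<in>L. exp (- \<bar>(v - c) / \<tau>\<bar>))"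
    using assms(1) by (subst sum.union_disjoint[symmetric]) (auto simp: R_def L_def intro!: sum.cong)
  also have "(\<Sum>v\<in>R. exp (- \<bar>(v - c) / \<tau>\<bar>)) = (\<Sum>t\<in>(\<lambda>v. v - c) ` R. exp (- t / \<tau>))"
    using assms by (subst sum.reindex) (auto simp: inj_on_def R_def intro!: sum.cong)
  also have "\<dots> \<le> 2 * \<tau> / \<delta>"
    using assms by (intro separated_exp_sum_one_sided) (auto simp: R_def)
  also have "(\<Sum>v\<in>L. exp (- \<bar>(v - c) / \<tau>\<bar>)) = (\<Sum>t\<in>(\<lambda>v. c - v) ` L. exp (- t / \<tau>))"
    using assms by (subst sum.reindex)
      (auto simp: inj_on_def L_def abs_div_pos intro!: sum.cong simp flip: minus_divide_left)
  also have "\<dots> \<le> 2 * \<tau> / \<delta>"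
    using assms by (intro separated_exp_sum_one_sided) (auto simp: L_def abs_minus_commute)
  finally show ?thesis by simp
qed

section \<open>Concentration and characteristic functions\<close>

text \<open>
  An inequality of Esseen type.  A multiple of the Gaussian \<open>exp (- ((x - x0) / \<tau>)\<^sup>2 / 2)\<close> dominates
  the indicator of the interval, and this Gaussian is itself an average of characters
  \<open>iexp (g (x - x0) / \<tau>)\<close> over standard normal \<open>g\<close>.
\<close>

lemma gaussian_smoothing_bound:
  assumes "real_distribution F" "\<tau> > 0"
  shows "measure F {x0 - \<tau> / 2 .. x0 + \<tau> / 2}
    \<le> exp (1 / 8) * (LINT g|std_normal_distribution. cmod (char F (g / \<tau>)))"
proof -
  let ?N = std_normal_distribution
  interpret F: real_distribution F by fact
  interpret N: real_distribution ?N by (rule real_dist_normal_dist)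
  interpret P: pair_prob_space F ?N ..
  define G where "G x = exp (- ((x - x0) / \<tau>)\<^sup>2 / 2)" for x
  have [measurable]: "G \<in> borel_measurable borel"
    unfolding G_def by measurable
  have intG: "integrable F G"
    by (intro F.integrable_const_bound[where B = 1]) (simp_all add: G_def[abs_def])
  have "measure F {x0 - \<tau> / 2 .. x0 + \<tau> / 2} = (LINT x|F. indicator {x0 - \<tau> / 2 .. x0 + \<tau> / 2} x)"
    by simp
  also have "\<dots> \<le> (LINT x|F. exp (1 / 8) * G x)"
  proof (intro integral_mono)
    show "integrable F (\<lambda>x. exp (1 / 8) * G x)" using intG by simp
    show "integrable F (\<lambda>x. indicator {x0 - \<tau> / 2 .. x0 + \<tau> / 2} x :: real)"
      by (intro F.integrable_const_bound[where B = 1]) (auto simp: indicator_def)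
    fix x
    show "indicator {x0 - \<tau> / 2 .. x0 + \<tau> / 2} x \<le> exp (1 / 8) * G x"
    proof (cases "x \<in> {x0 - \<tau> / 2 .. x0 + \<tau> / 2}")
      case True
      then have "\<bar>x - x0\<bar> \<le> \<tau> / 2" by (intro abs_leI) auto
      then have "\<bar>(x - x0) / \<tau>\<bar> \<le> 1 / 2" using assms(2) by (simp add: field_simps)
      then have "((x - x0) / \<tau>)\<^sup>2 \<le> (1 / 2)\<^sup>2"
        unfolding abs_le_square_iff[symmetric] by simp
      then have "0 \<le> 1 / 8 + - ((x - x0) / \<tau>)\<^sup>2 / 2" by (simp add: power_one_over)
      then have "1 \<le> exp (1 / 8) * G x" unfolding G_def exp_add[symmetric] by simp
      with True show ?thesis by simp
    next
      case False
      then show ?thesis by (simp add: G_def)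
    qed
  qed
  also have "\<dots> = exp (1 / 8) * (LINT x|F. G x)" by simp
  also have "(LINT x|F. G x) \<le> (LINT g|?N. cmod (char F (g / \<tau>)))"
  proof -
    have G_eq: "complex_of_real (G x) = (CLINT g|?N. iexp ((x - x0) / \<tau> * g))" for x
      using fun_cong[OF char_std_normal_distribution, of "(x - x0) / \<tau>"]
      unfolding char_def G_def by (rule sym)
    have "complex_of_real (LINT x|F. G x) = (CLINT x|F. of_real (G x))" by simp
    (* The Gaussian is read as the characteristic function of a standard normal variable. *)
    also have "\<dots> = (CLINT x|F. (CLINT g|?N. iexp ((x - x0) / \<tau> * g)))"
      unfolding G_eq ..
    also have "\<dots> = (CLINT g|?N. (CLINT x|F. iexp ((x - x0) / \<tau> * g)))"
      by (intro P.Fubini_integral[symmetric] P.integrable_const_bound[where B = 1])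
         (auto simp: case_prod_unfold simp del: of_real_mult of_real_divide)
    also have "\<dots> = (CLINT g|?N. iexp (- x0 / \<tau> * g) * char F (g / \<tau>))"
      unfolding char_def integral_mult_right_zero[symmetric] exp_add[symmetric]
      by (intro Bochner_Integration.integral_cong refl arg_cong[where f = exp])
         (simp add: algebra_simps diff_divide_distrib)
    finally have "(LINT x|F. G x) = cmod (CLINT g|?N. iexp (- x0 / \<tau> * g) * char F (g / \<tau>))"
      by (metis (no_types, lifting) G_def exp_ge_zero Bochner_Integration.integral_nonneg norm_of_real abs_of_nonneg)
    also have "\<dots> \<le> (LINT g|?N. cmod (iexp (- x0 / \<tau> * g) * char F (g / \<tau>)))"
      by (rule integral_norm_bound)
    also have "\<dots> = (LINT g|?N. cmod (char F (g / \<tau>)))"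
      by (simp add: norm_mult del: of_real_mult of_real_divide of_real_minus)
    finally show ?thesis .
  qed
  finally show ?thesis by simp
qed

lemma char_weighted_iid_sum:
  assumes "real_distribution \<mu>"
  shows "char (distr (iid_space n \<mu>) borel (\<lambda>x. \<Sum>k=1..n. x k * a k)) t = (\<Prod>k=1..n. char \<mu> (t * a k))"
proof -
  interpret real_distribution \<mu> by fact
  have int: "integrable \<mu> (\<lambda>x. iexp (s * x))" for s
    by (intro integrable_iexp) auto
  interpret product_prob_space "\<lambda>_::nat. \<mu>" ..
  have meas: "(\<lambda>x. \<Sum>k=1..n. x k * a k) \<in> borel_measurable (iid_space n \<mu>)"
    unfolding iid_space_def by measurable
  have "char (distr (iid_space n \<mu>) borel (\<lambda>x. \<Sum>k=1..n. x k * a k)) t =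
      (CLINT x|iid_space n \<mu>. iexp (t * (\<Sum>k=1..n. x k * a k)))"
    unfolding char_def by (intro integral_distr meas) measurable
  also have "\<dots> = (CLINT x|iid_space n \<mu>. (\<Prod>k=1..n. iexp (t * a k * x k)))"
    by (simp add: exp_sum sum_distrib_left mult_ac)
  also have "\<dots> = (\<Prod>k=1..n. char \<mu> (t * a k))"
    unfolding char_def iid_space_def
    by (intro product_integral_prod int) simp
  finally show ?thesis .
qed

lemma real_distribution_weighted_iid_sum:
  assumes "real_distribution \<mu>"
  shows "real_distribution (distr (iid_space n \<mu>) borel (\<lambda>x. \<Sum>k=1..n. x k * a k))"
proof -
  interpret real_distribution \<mu> by fact
  have "(\<lambda>x. \<Sum>k=1..n. x k * a k) \<in> borel_measurable (iid_space n \<mu>)"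
    unfolding iid_space_def by measurable
  then have "prob_space (distr (iid_space n \<mu>) borel (\<lambda>x. \<Sum>k=1..n. x k * a k))"
    unfolding iid_space_def
    by (intro prob_space.prob_space_distr prob_space_PiM) (rule prob_space_axioms)
  then show ?thesis
    unfolding real_distribution_def real_distribution_axioms_def by simp
qed

lemma norm_char_sq_eq_symmetrized:
  assumes "real_distribution \<mu>"
  shows "(cmod (char \<mu> s))\<^sup>2 = (LINT z|(\<mu> \<Otimes>\<^sub>M \<mu>). cos (s * (fst z - snd z)))"
proof -
  interpret real_distribution \<mu> by fact
  interpret P: pair_prob_space \<mu> \<mu> ..
  define C where "C = (LINT x|\<mu>. cos (s * x))"
  define S where "S = (LINT x|\<mu>. sin (s * x))"
  have int: "integrable \<mu> (\<lambda>x. cos (s * x))" "integrable \<mu> (\<lambda>x. sin (s * x))"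
    by (auto intro!: integrable_const_bound[where B = 1])
  have iint: "integrable \<mu> (\<lambda>x. iexp (s * x))"
    by (intro integrable_iexp) auto
  have "Re (char \<mu> s) = C" "Im (char \<mu> s) = S"
    using iint unfolding char_def C_def S_def
    by (simp_all add: Re_exp Im_exp flip: integral_Re integral_Im)
  then have "(cmod (char \<mu> s))\<^sup>2 = C * C + S * S"
    unfolding cmod_power2 by (simp add: power2_eq_square)
  also have "\<dots> = (LINT x|\<mu>. cos (s * x) * C + sin (s * x) * S)"
    using int by (simp add: C_def S_def)
  also have "\<dots> = (LINT x|\<mu>. (LINT y|\<mu>. cos (s * (fst (x, y) - snd (x, y)))))"
    using int by (simp add: C_def S_def right_diff_distrib cos_diff)
  also have "\<dots> = (LINT z|(\<mu> \<Otimes>\<^sub>M \<mu>). cos (s * (fst z - snd z)))"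
    by (intro P.integral_fst' P.integrable_const_bound[where B = 1]) auto
  finally show ?thesis .
qed

text \<open>
  Both the restriction to pairs in \<open>E\<close> and the passage from \<open>x\<^sup>2\<close> to \<open>exp (x\<^sup>2 - 1)\<close> only lose.  The
  exponential form turns products over summands into sums, to which convexity applies.
\<close>

lemma norm_char_le_exp_spread:
  assumes "real_distribution \<mu>" and E: "E \<in> sets (\<mu> \<Otimes>\<^sub>M \<mu>)"
  shows "cmod (char \<mu> s) \<le>
    exp (- ((LINT z|(\<mu> \<Otimes>\<^sub>M \<mu>). indicator E z * (1 - cos (s * (fst z - snd z)))) / 2))"
proof -
  interpret real_distribution \<mu> by fact
  interpret P: pair_prob_space \<mu> \<mu> ..
  define J where "J = (LINT z|(\<mu> \<Otimes>\<^sub>M \<mu>). indicator E z * (1 - cos (s * (fst z - snd z))))"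
  have bnd: "\<bar>1 - cos x\<bar> \<le> 2" for x :: real
    using cos_le_one[of x] cos_ge_minus_one[of x] by (simp add: abs_le_iff)
  have int: "integrable (\<mu> \<Otimes>\<^sub>M \<mu>) (\<lambda>z. cos (s * (fst z - snd z)))"
    by (intro P.integrable_const_bound[where B = 1]) auto
  have "J \<le> (LINT z|(\<mu> \<Otimes>\<^sub>M \<mu>). 1 - cos (s * (fst z - snd z)))"
    unfolding J_def
  proof (intro integral_mono)
    show "integrable (\<mu> \<Otimes>\<^sub>M \<mu>) (\<lambda>z. indicator E z * (1 - cos (s * (fst z - snd z))))"
      using E bnd by (intro P.integrable_const_bound[where B = 2])
        (auto simp: indicator_def)
  qed (use int in \<open>auto simp: indicator_def\<close>)
  also have "\<dots> = 1 - (cmod (char \<mu> s))\<^sup>2"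
    using int by (simp add: norm_char_sq_eq_symmetrized[OF assms(1)] P.prob_space)
  finally have "(cmod (char \<mu> s))\<^sup>2 \<le> 1 + (- J)" by simp
  also have "\<dots> \<le> exp (- J)" by (rule exp_ge_add_one_self)
  also have "\<dots> = (exp (- (J / 2)))\<^sup>2" by (simp flip: exp_double)
  finally show ?thesis unfolding J_def by (rule power2_le_imp_le) simp
qed

text \<open>
  Jensen's inequality for the exponential function and the uniform distribution on
  \<open>E \<times> {..<m}\<close>.  It separates the blocks \<open>B i\<close> and multiplies each exponent by the total mass
  \<open>measure P E * m\<close>: although each pair in \<open>E\<close> is rare, enough blocks bring the factor back to a
  constant size.
\<close>

lemma exp_neg_integral_sum_le:
  fixes B :: "nat \<Rightarrow> 'a \<Rightarrow> real"
  assumes "prob_space P" and E: "E \<in> sets P" and p: "measure P E > 0" and m: "m > 0"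
    and B: "\<And>i. i < m \<Longrightarrow> B i \<in> borel_measurable P" "\<And>i z. i < m \<Longrightarrow> 0 \<le> B i z \<and> B i z \<le> C"
  shows "exp (- (LINT z|P. indicator E z * (\<Sum>i<m. B i z)))
    \<le> (\<Sum>i<m. LINT z|P. indicator E z * exp (- (measure P E * m * B i z))) / (measure P E * m)"
proof -
  interpret prob_space P by fact
  define q where "q = measure P E * m"
  define A where "A = (LINT z|P. indicator E z * (\<Sum>i<m. B i z))"
  have q: "q > 0" using p m by (simp add: q_def)
  have intB: "integrable P (\<lambda>z. indicator E z * B i z)" if "i < m" for i
    using that B E by (intro integrable_const_bound[where B = C]) (auto simp: indicator_def intro: order_trans)
  have intE: "integrable P (\<lambda>z. indicator E z * exp (- (q * B i z)))" if "i < m" for i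
    using that B[of i] E q by (intro integrable_const_bound[where B = 1]) (auto simp: indicator_def)
  have intc: "integrable P (\<lambda>z. indicator E z * c)" for c :: real
    using E by (intro integrable_const_bound[where B = "\<bar>c\<bar>"]) (auto simp: indicator_def)
  have A_eq: "A = (\<Sum>i<m. LINT z|P. indicator E z * B i z)"
    unfolding A_def sum_distrib_left using intB by (intro Bochner_Integration.integral_sum) auto
  have "exp (- A) * q = (\<Sum>i<m. exp (- A) * ((1 + A) * measure P E - q * (LINT z|P. indicator E z * B i z)))"
    by (simp only: sum_distrib_left[symmetric] sum_subtractf A_eq[symmetric])
       (simp add: q_def algebra_simps)
  also have "\<dots> \<le> (\<Sum>i<m. LINT z|P. indicator E z * exp (- (q * B i z)))"
  proof (intro sum_mono)
    fix i assume "i \<in> {..<m}"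
    then have i: "i < m" by simp
    have "exp (- A) * ((1 + A) * measure P E - q * (LINT z|P. indicator E z * B i z)) =
        (LINT z|P. exp (- A) * (indicator E z * (1 + A) - q * (indicator E z * B i z)))"
      using intB[OF i] intc[of "1 + A"] E sets.sets_into_space[OF E]
      by (simp add: Int_absorb1 mult.commute)
    also have "\<dots> \<le> (LINT z|P. indicator E z * exp (- (q * B i z)))"
    proof (intro integral_mono)
      fix z
      (* The tangent of the exponential function at the mean value of the exponent. *)
      have "exp (- A) * (1 + (A - q * B i z)) \<le> exp (- A) * exp (A - q * B i z)"
        by (intro mult_left_mono exp_ge_add_one_self) auto
      also have "\<dots> = exp (- (q * B i z))" by (simp flip: exp_add)
      finally show "exp (- A) * (indicator E z * (1 + A) - q * (indicator E z * B i z))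
          \<le> indicator E z * exp (- (q * B i z))"
        by (auto simp: indicator_def algebra_simps)
    qed (use intB[OF i] intE[OF i] intc in auto)
    finally show "exp (- A) * ((1 + A) * measure P E - q * (LINT z|P. indicator E z * B i z))
      \<le> (LINT z|P. indicator E z * exp (- (q * B i z)))" .
  qed
  finally show ?thesis using q unfolding A_def[symmetric] q_def[symmetric]
    by (simp add: pos_le_divide_eq)
qed

section \<open>Concentration forced down by dissociated blocks\<close>

lemma integral_cos_std_normal:
  "(LINT g|std_normal_distribution. cos (s * g)) = exp (- s\<^sup>2 / 2)"
  "integrable std_normal_distribution (\<lambda>g. cos (s * g))"
proof -
  interpret N: real_distribution std_normal_distribution by (rule real_dist_normal_dist)
  have iint: "integrable std_normal_distribution (\<lambda>x. iexp (s * x))"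
    by (intro N.integrable_iexp) auto
  have "Re (char std_normal_distribution s) = (LINT g|std_normal_distribution. cos (s * g))"
    using iint unfolding char_def by (simp add: Re_exp flip: integral_Re)
  then show "(LINT g|std_normal_distribution. cos (s * g)) = exp (- s\<^sup>2 / 2)"
    by (simp add: char_std_normal_distribution)
  show "integrable std_normal_distribution (\<lambda>g. cos (s * g))"
    by (intro N.integrable_const_bound[where B = 1]) auto
qed

text \<open>
  After the expansion, the Gaussian average turns every cosine into a Gaussian in the difference
  of two subset sums.  A factor \<open>\<bar>y\<bar> \<ge> 1\<close> only spreads the subset sums further apart; this is how
  the values of the random variables disappear from the estimate.
\<close>

lemma integral_dissociated_prod_le:
  assumes "dissociated \<delta> us" "0 < \<delta>" "\<delta> \<le> \<tau>" "\<bar>y\<bar> \<ge> 1"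
  shows "(LINT g|std_normal_distribution. (\<Prod>u\<leftarrow>us. bern_diff_char (u * (y / \<tau> * g))))
    \<le> 8 * \<tau> / \<delta> * (3 / 4) ^ length us"
proof -
  obtain V w where V: "finite V" "\<And>x y. x \<in> V \<Longrightarrow> y \<in> V \<Longrightarrow> x \<noteq> y \<Longrightarrow> \<delta> < \<bar>x - y\<bar>"
    and w: "\<And>v. v \<in> V \<Longrightarrow> 0 \<le> w v" "\<And>v. v \<in> V \<Longrightarrow> w v \<le> (3 / 4) ^ length us" "sum w V = 1"
    and eq: "\<And>x. (\<Prod>u\<leftarrow>us. bern_diff_char (u * x)) = (\<Sum>v\<in>V. \<Sum>v'\<in>V. w v * w v' * cos ((v - v') * x))"
    by (rule prod_bern_diff_char_expansion[OF less_imp_le[OF assms(2)] assms(1)])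
       (rule that; assumption)
  have "(LINT g|std_normal_distribution. (\<Prod>u\<leftarrow>us. bern_diff_char (u * (y / \<tau> * g)))) =
      (LINT g|std_normal_distribution. (\<Sum>v\<in>V. \<Sum>v'\<in>V. w v * w v' * cos ((v - v') * (y / \<tau>) * g)))"
    unfolding eq mult.assoc ..
  also have "\<dots> = (\<Sum>v\<in>V. LINT g|std_normal_distribution. (\<Sum>v'\<in>V. w v * w v' * cos ((v - v') * (y / \<tau>) * g)))"
    by (intro Bochner_Integration.integral_sum Bochner_Integration.integrable_sum
        integrable_mult_right integral_cos_std_normal)
  also have "\<dots> = (\<Sum>v\<in>V. \<Sum>v'\<in>V. LINT g|std_normal_distribution. w v * w v' * cos ((v - v') * (y / \<tau>) * g))"
    by (intro sum.cong refl Bochner_Integration.integral_sum integrable_mult_right integral_cos_std_normal)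
  also have "\<dots> = (\<Sum>v\<in>V. \<Sum>v'\<in>V. w v * w v' * exp (- ((v - v') * (y / \<tau>))\<^sup>2 / 2))"
    by (simp only: integral_mult_right_zero integral_cos_std_normal)
  also have "\<dots> = (\<Sum>v'\<in>V. \<Sum>v\<in>V. w v * w v' * exp (- ((v - v') * (y / \<tau>))\<^sup>2 / 2))"
    by (rule sum.swap)
  also have "\<dots> \<le> (\<Sum>v'\<in>V. \<Sum>v\<in>V. (3 / 4) ^ length us * w v' * exp (- ((v - v') / \<tau>)\<^sup>2 / 2))"
  proof (intro sum_mono mult_mono)
    fix v v' assume "v \<in> V" "v' \<in> V"
    have "1 \<le> y\<^sup>2" using assms(4) abs_le_square_iff[of 1 y] by simp
    then have "((v - v') / \<tau>)\<^sup>2 * 1 \<le> ((v - v') / \<tau>)\<^sup>2 * y\<^sup>2" by (intro mult_left_mono) auto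
    also have "\<dots> = ((v - v') * (y / \<tau>))\<^sup>2" by (simp add: power_mult_distrib power_divide)
    finally show "exp (- ((v - v') * (y / \<tau>))\<^sup>2 / 2) \<le> exp (- ((v - v') / \<tau>)\<^sup>2 / 2)" by simp
  qed (use w in auto)
  also have "\<dots> = (\<Sum>v'\<in>V. (3 / 4) ^ length us * w v' * (\<Sum>v\<in>V. exp (- ((v - v') / \<tau>)\<^sup>2 / 2)))"
    by (simp add: sum_distrib_left)
  also have "\<dots> \<le> (\<Sum>v'\<in>V. (3 / 4) ^ length us * w v' * (8 * \<tau> / \<delta>))"
    using V w assms by (intro sum_mono mult_left_mono separated_gaussian_sum) auto
  also have "\<dots> = 8 * \<tau> / \<delta> * (3 / 4) ^ length us"
    by (simp only: sum_distrib_left[symmetric] sum_distrib_right[symmetric] w(3)) simp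
  finally show ?thesis .
qed

lemma bern_diff_char_bounds: "0 \<le> bern_diff_char x" "bern_diff_char x \<le> 1"
proof -
  have "0 \<le> 1 - 3 / 8 * (1 - c) \<and> 1 - 3 / 8 * (1 - c) \<le> 1" if "- 1 \<le> c" "c \<le> 1" for c :: real
    using that by auto
  from this[OF cos_ge_minus_one cos_le_one]
  show "0 \<le> bern_diff_char x" "bern_diff_char x \<le> 1" by (auto simp: bern_diff_char_def)
qed

text \<open>
  Jensen's inequality is applied to one pair \<open>z\<close> of independent copies for all summands at once, so
  all entries of a block get the same factor \<open>D z\<close> and the block stays dissociated.  Only pairs with \<open>\<bar>D z\<bar> > 1\<close> are kept, and their probability times the number of
  blocks is at least \<open>2\<close>, which is what the comparison with \<^const>\<open>bern_diff_char\<close> requires.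
\<close>

lemma concentration_le_of_dissociated_blocks:
  fixes a :: "nat \<Rightarrow> real"
  assumes \<mu>: "real_distribution \<mu>" and p: "sym_tail \<mu> 1 > 0"
    and bs: "distinct (concat bs)" "set (concat bs) \<subseteq> {1..n}" "sym_tail \<mu> 1 * length bs \<ge> 2"
    and dis: "\<And>ks. ks \<in> set bs \<Longrightarrow> length ks = r \<and> dissociated \<delta> (map a ks)"
    and \<delta>: "0 < \<delta>" "\<delta> \<le> \<tau>"
  shows "measure (distr (iid_space n \<mu>) borel (\<lambda>x. \<Sum>k=1..n. x k * a k)) {x0 - \<tau> / 2 .. x0 + \<tau> / 2}
    \<le> exp (1 / 8) * (8 * \<tau> / \<delta> * (3 / 4) ^ r)"
proof -
  let ?N = std_normal_distribution
  define F where "F = distr (iid_space n \<mu>) borel (\<lambda>x. \<Sum>k=1..n. x k * a k)"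
  define P where "P = \<mu> \<Otimes>\<^sub>M \<mu>"
  define E where "E = {(x, y). \<bar>x - y\<bar> > (1::real)}"
  define D where "D z = fst z - snd z" for z :: "real \<times> real"
  define m where "m = length bs"
  define q where "q = measure P E * m"
  define bound where "bound = 8 * \<tau> / \<delta> * (3 / 4) ^ r"
  interpret \<mu>: real_distribution \<mu> by fact
  interpret N: real_distribution ?N by (rule real_dist_normal_dist)
  interpret PP: pair_prob_space \<mu> \<mu> ..
  interpret P: prob_space P unfolding P_def by (rule PP.prob_space_axioms)
  interpret NP: pair_prob_space ?N P ..
  have setsP[measurable_cong]: "sets P = sets (borel \<Otimes>\<^sub>M borel)"
    unfolding P_def by (intro sets_pair_measure_cong) auto
  have [measurable]: "D \<in> borel_measurable P"
    unfolding D_def P_def by measurable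
  have E[measurable]: "E \<in> sets P"
    unfolding setsP borel_prod E_def case_prod_unfold
    by (intro borel_open open_Collect_less continuous_intros)
  have pE: "measure P E = sym_tail \<mu> 1" by (simp add: P_def E_def sym_tail_def)
  have m: "m > 0" using bs(3) by (cases "m = 0") (auto simp: m_def)
  have q: "q \<ge> 2" using bs(3) by (simp add: q_def pE m_def)
  have F: "real_distribution F"
    unfolding F_def by (rule real_distribution_weighted_iid_sum[OF \<mu>])
  have distinct_block: "distinct (bs ! i)" if "i < m" for i
    using bs(1) that by (simp add: m_def distinct_concat_iff)
  define \<Psi> where "\<Psi> i t = (\<Prod>k\<in>set (bs ! i). bern_diff_char (a k * t))" for i t
  have \<Psi>_bounds: "0 \<le> \<Psi> i t" "\<Psi> i t \<le> 1" for i t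
    unfolding \<Psi>_def by (auto intro!: prod_nonneg prod_le_1 simp: bern_diff_char_bounds)
  have \<Psi>_meas[measurable]: "\<Psi> i \<in> borel_measurable borel" for i
    unfolding \<Psi>_def bern_diff_char_def by measurable
  have char_le: "cmod (char F t) \<le> (\<Sum>i<m. LINT z|P. indicator E z * \<Psi> i (D z * t)) / q" for t
  proof -
    define J where "J k = (LINT z|P. indicator E z * (1 - cos (t * a k * D z)))" for k
    define B where "B i z = (\<Sum>k\<in>set (bs ! i). 1 - cos (t * a k * D z)) / 2" for i z
    have bnd: "0 \<le> 1 - cos x" "1 - cos x \<le> 2" for x :: real
      using cos_le_one[of x] cos_ge_minus_one[of x] by auto
    have J_nonneg: "J k \<ge> 0" for k
      unfolding J_def by (intro Bochner_Integration.integral_nonneg) (auto simp: indicator_def)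
    have intJ: "integrable P (\<lambda>z. indicator E z * (1 - cos (t * a k * D z)))" for k
      using bnd E by (intro P.integrable_const_bound[where B = 2]) (auto simp: indicator_def abs_le_iff)
    have "cmod (char F t) = (\<Prod>k=1..n. cmod (char \<mu> (t * a k)))"
      unfolding F_def char_weighted_iid_sum[OF \<mu>] by (simp add: prod_norm)
    also have "\<dots> \<le> (\<Prod>k=1..n. exp (- (J k / 2)))"
      using norm_char_le_exp_spread[OF \<mu> E[unfolded P_def]]
      by (intro prod_mono) (auto simp: J_def D_def P_def)
    also have "\<dots> = exp (- (\<Sum>k=1..n. J k / 2))"
      by (simp add: exp_sum flip: sum_negf)
    also have "\<dots> \<le> exp (- (\<Sum>k\<in>set (concat bs). J k / 2))"
      using bs(2) J_nonneg by (simp add: sum_mono2 del: set_concat)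
    also have "(\<Sum>k\<in>set (concat bs). J k / 2) = (\<Sum>i<m. \<Sum>k\<in>set (bs ! i). J k / 2)"
    proof -
      have "(\<Sum>k\<in>set (concat bs). J k / 2) = (\<Sum>k\<leftarrow>concat bs. J k / 2)"
        using bs(1) by (simp add: sum_list_distinct_conv_sum_set)
      also have "\<dots> = (\<Sum>ks\<leftarrow>bs. \<Sum>k\<leftarrow>ks. J k / 2)"
        by (induction bs) auto
      also have "\<dots> = (\<Sum>i<m. \<Sum>k\<leftarrow>bs ! i. J k / 2)"
        by (simp add: sum_list_sum_nth m_def atLeast0LessThan)
      also have "\<dots> = (\<Sum>i<m. \<Sum>k\<in>set (bs ! i). J k / 2)"
        using distinct_block by (intro sum.cong) (auto simp: sum_list_distinct_conv_sum_set)
      finally show ?thesis .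
    qed
    also have "\<dots> = (LINT z|P. indicator E z * (\<Sum>i<m. B i z))"
      unfolding J_def B_def sum_distrib_left sum_divide_distrib
      using intJ by (simp add: Bochner_Integration.integral_sum)
    also have "exp (- \<dots>) \<le> (\<Sum>i<m. LINT z|P. indicator E z * exp (- (q * B i z))) / q"
      unfolding q_def
    proof (rule exp_neg_integral_sum_le)
      show "prob_space P" by (rule P.prob_space_axioms)
      show "B i \<in> borel_measurable P" for i unfolding B_def by measurable
      show "0 \<le> B i z \<and> B i z \<le> (\<Sum>i<m. real (card (set (bs ! i))))" if "i < m" for i z
      proof
        show "0 \<le> B i z" unfolding B_def by (intro divide_nonneg_nonneg sum_nonneg bnd) auto
        have "B i z \<le> real (card (set (bs ! i))) * 2 / 2"
          unfolding B_def by (intro divide_right_mono sum_bounded_above bnd) auto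
        also have "\<dots> \<le> (\<Sum>i<m. real (card (set (bs ! i))))"
          using that member_le_sum[of i "{..<m}" "\<lambda>i. real (card (set (bs ! i)))"] by simp
        finally show "B i z \<le> (\<Sum>i<m. real (card (set (bs ! i))))" .
      qed
    qed (use p pE m E in auto)
    also have "\<dots> \<le> (\<Sum>i<m. LINT z|P. indicator E z * \<Psi> i (D z * t)) / q"
    proof (intro divide_right_mono sum_mono integral_mono mult_left_mono)
      fix i z
      show "exp (- (q * B i z)) \<le> \<Psi> i (D z * t)"
      proof -
        have "exp (- (q * B i z)) = (\<Prod>k\<in>set (bs ! i). exp (- (q / 2) * (1 - cos (t * a k * D z))))"
          by (simp add: B_def sum_distrib_left sum_divide_distrib flip: exp_sum sum_negf)
        also have "\<dots> \<le> \<Psi> i (D z * t)"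
          unfolding \<Psi>_def using exp_le_bern_diff_char[of "q / 2"] q
          by (intro prod_mono) (auto simp: mult_ac)
        finally show ?thesis .
      qed
    next
      fix i
      have B0: "0 \<le> q * B i z" for z unfolding B_def using q
        by (intro mult_nonneg_nonneg divide_nonneg_nonneg sum_nonneg bnd) auto
      have [measurable]: "B i \<in> borel_measurable P" unfolding B_def by measurable
      show "integrable P (\<lambda>z. indicator E z * exp (- (q * B i z)))"
        using B0 by (intro P.integrable_const_bound[where B = 1]) (auto simp: indicator_def)
      show "integrable P (\<lambda>z. indicator E z * \<Psi> i (D z * t))"
        using \<Psi>_bounds by (intro P.integrable_const_bound[where B = 1]) (auto simp: indicator_def)
    qed (use q in auto)
    finally show ?thesis .
  qed
  have int: "integrable (?N \<Otimes>\<^sub>M P) (\<lambda>(g, z). indicator E z * \<Psi> i (D z * (g / \<tau>)))" for i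
    using \<Psi>_bounds by (intro NP.integrable_const_bound[where B = 1])
      (auto simp: indicator_def case_prod_unfold)
  have int_fst: "integrable ?N (\<lambda>g. LINT z|P. indicator E z * \<Psi> i (D z * (g / \<tau>)))" for i
    using int by (rule NP.integrable_fst)
  have block_le: "(LINT g|?N. LINT z|P. indicator E z * \<Psi> i (D z * (g / \<tau>))) \<le> measure P E * bound"
    if "i < m" for i
  proof -
    have "(LINT g|?N. LINT z|P. indicator E z * \<Psi> i (D z * (g / \<tau>))) =
        (LINT z|P. LINT g|?N. indicator E z * \<Psi> i (D z * (g / \<tau>)))"
      using int by (rule NP.Fubini_integral[symmetric])
    also have "\<dots> \<le> (LINT z|P. indicator E z * bound)"
    proof (intro integral_mono)
      show "integrable P (\<lambda>z. LINT g|?N. indicator E z * \<Psi> i (D z * (g / \<tau>)))"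
        using int by (rule NP.integrable_snd)
      show "integrable P (\<lambda>z. indicator E z * bound)"
        by (intro P.integrable_const_bound[where B = "\<bar>bound\<bar>"]) (auto simp: indicator_def)
      fix z
      show "(LINT g|?N. indicator E z * \<Psi> i (D z * (g / \<tau>))) \<le> indicator E z * bound"
      proof (cases "z \<in> E")
        case True
        then have "\<bar>D z\<bar> \<ge> 1" by (auto simp: E_def D_def)
        moreover have "bs ! i \<in> set bs" using that by (simp add: m_def)
        ultimately have "(LINT g|?N. (\<Prod>u\<leftarrow>map a (bs ! i). bern_diff_char (u * (D z / \<tau> * g)))) \<le> bound"
          using integral_dissociated_prod_le[of \<delta> "map a (bs ! i)" \<tau> "D z"] dis[of "bs ! i"] \<delta>
          by (simp add: bound_def)
        then show ?thesis
          using True distinct_block[OF that] by (simp add: \<Psi>_def prod.distinct_set_conv_list comp_def)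
      qed simp
    qed
    also have "\<dots> = measure P E * bound"
      using sets.sets_into_space[OF E] by (simp add: Int_absorb1)
    finally show ?thesis .
  qed
  have "(LINT g|?N. cmod (char F (g / \<tau>))) \<le>
      (LINT g|?N. (\<Sum>i<m. LINT z|P. indicator E z * \<Psi> i (D z * (g / \<tau>))) / q)"
  proof (intro integral_mono char_le)
    interpret F: real_distribution F by fact
    show "integrable ?N (\<lambda>g. cmod (char F (g / \<tau>)))"
      by (intro N.integrable_const_bound[where B = 1]) (auto simp: F.cmod_char_le_1)
    show "integrable ?N (\<lambda>g. (\<Sum>i<m. LINT z|P. indicator E z * \<Psi> i (D z * (g / \<tau>))) / q)"
      using int_fst by (intro integrable_divide_zero Bochner_Integration.integrable_sum)
  qed
  also have "\<dots> = (\<Sum>i<m. LINT g|?N. LINT z|P. indicator E z * \<Psi> i (D z * (g / \<tau>))) / q"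
    using int_fst by (simp add: Bochner_Integration.integral_sum)
  also have "\<dots> \<le> (\<Sum>i<m. measure P E * bound) / q"
    using q by (intro divide_right_mono sum_mono block_le) auto
  also have "\<dots> = bound" using p pE m by (simp add: q_def)
  finally have "(LINT g|?N. cmod (char F (g / \<tau>))) \<le> bound" .
  moreover have "measure F {x0 - \<tau> / 2 .. x0 + \<tau> / 2} \<le> exp (1 / 8) * (LINT g|?N. cmod (char F (g / \<tau>)))"
    using gaussian_smoothing_bound[OF F] \<delta> by simp
  ultimately show ?thesis
    unfolding F_def bound_def by (smt (verit) exp_gt_zero mult_left_mono)
qed

section \<open>One coordinate\<close>

text \<open>
  The length \<open>r\<close> of a block is chosen so that \<open>(3 / 4) ^ r\<close> outweighs \<open>n powr (A + B)\<close> together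
  with the absolute constants.
\<close>

lemma block_bound_less_powr:
  fixes n r :: nat and A B :: real
  assumes "n \<ge> 1" "A > 0" "B > 0" "\<rho> \<le> real n powr B" "\<rho> > 0"
    and r: "16 * ((A + B) * ln (real n) + 1) \<le> real r"
  shows "exp (1 / 8) * (8 * \<rho> * (3 / 4) ^ r) < real n powr (- A)"
proof -
  define l where "l = (A + B) * ln (real n)"
  have l: "l \<ge> 0" using assms by (simp add: l_def)
  have "(3 / 4 :: real) \<le> exp (- (1 / 4))" using exp_ge_add_one_self[of "- (1 / 4) :: real"] by simp
  then have "(3 / 4 :: real) ^ r \<le> exp (- (1 / 4)) ^ r" by (intro power_mono) auto
  also have "\<dots> = exp (- (real r / 4))" by (simp flip: exp_of_nat_mult)
  also have "\<dots> \<le> exp (- 4 * (l + 1))" using r by (simp add: l_def)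
  also have "\<dots> \<le> exp (- l - 4)" using l by simp
  finally have pow: "(3 / 4 :: real) ^ r \<le> exp (- l - 4)" .
  have "exp (1 / 8 :: real) \<le> exp 1" by simp
  also have "\<dots> \<le> 3" by (rule exp_le)
  finally have e1: "exp (1 / 8 :: real) * 8 \<le> 24" by simp
  have "(5 :: real) \<le> exp 2" using exp_lower_Taylor_quadratic[of "2 :: real"] by simp
  then have "(5 * 5 :: real) \<le> exp 2 * exp 2" by (intro mult_mono) auto
  then have e4: "(25 :: real) \<le> exp 4" by (simp flip: exp_add)
  have "exp (1 / 8) * (8 * \<rho> * (3 / 4) ^ r) = (exp (1 / 8) * 8) * \<rho> * (3 / 4) ^ r" by simp
  also have "\<dots> < exp 4 * \<rho> * (3 / 4) ^ r"
    using e1 e4 assms by (intro mult_strict_right_mono) auto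
  also have "\<dots> \<le> exp 4 * real n powr B * exp (- l - 4)"
    using assms pow by (intro mult_mono) auto
  also have "\<dots> = exp (4 + B * ln (real n) + (- l - 4))"
    using assms by (simp add: powr_def flip: exp_add)
  also have "\<dots> = real n powr (- A)" using assms by (simp add: powr_def l_def algebra_simps)
  finally show ?thesis .
qed

text \<open>
  About \<open>2 / p\<close> disjoint dissociated blocks of length about \<open>16 L\<close> would force the concentration below
  \<open>n powr (- A)\<close>.  So the greedy choice runs out of blocks, and what it leaves uncovered has at
  most about \<open>(2 / p) * 16 L\<close> elements.
\<close>

lemma concentrated_imp_few_exceptions:
  fixes a :: "nat \<Rightarrow> real"
  assumes \<mu>: "real_distribution \<mu>" and p: "sym_tail \<mu> 1 > 0"
    and AB: "n \<ge> 1" "A > 0" "B > 0" and \<delta>: "0 \<le> \<delta>" "\<delta> \<le> \<tau>"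
    and ratio: "ext_ratio \<tau> \<delta> \<le> ereal (real n powr B)"
    and conc: "real n powr (- A)
      \<le> concentration (distr (iid_space n \<mu>) borel (\<lambda>x. \<Sum>k=1..n. x k * a k)) \<tau>"
  shows "\<exists>us. real (length us) \<le> 17 * ((A + B) * ln (real n) + 1) \<and> 0 \<notin> set us \<and>
    sym_tail \<mu> 1 * real (card {k \<in> {1..n}. \<not> near_cube \<delta> us (a k)}) \<le> 51 * ((A + B) * ln (real n) + 1)"
proof -
  define p where "p = sym_tail \<mu> 1"
  define L where "L = (A + B) * ln (real n) + 1"
  define F where "F = distr (iid_space n \<mu>) borel (\<lambda>x. \<Sum>k=1..n. x k * a k)"
  define r where "r = nat \<lceil>16 * L\<rceil>"
  define m where "m = nat \<lceil>2 / p\<rceil>"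
  interpret \<mu>: real_distribution \<mu> by fact
  interpret PP: pair_prob_space \<mu> \<mu> ..
  interpret F: real_distribution F
    unfolding F_def by (rule real_distribution_weighted_iid_sum[OF \<mu>])
  have p_bounds: "0 < p" "p \<le> 1" using p by (auto simp: p_def sym_tail_def)
  have L: "L \<ge> 1" using AB by (simp add: L_def)
  have r: "16 * L \<le> real r" "real r \<le> 17 * L" using L by (simp_all add: r_def) linarith+
  have "2 / p \<le> real m" "real m \<le> 2 / p + 1" using p_bounds by (simp_all add: m_def)
  then have m: "2 \<le> p * real m" "p * real m \<le> 3" using p_bounds by (simp_all add: field_simps)
  have no_blocks: "\<not> (\<exists>bs. length bs = m \<and> distinct (concat bs) \<and> set (concat bs) \<subseteq> {1..n} \<and>
            (\<forall>ks\<in>set bs. length ks = r \<and> dissociated \<delta> (map a ks)))"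
  proof
    assume "\<exists>bs. length bs = m \<and> distinct (concat bs) \<and> set (concat bs) \<subseteq> {1..n} \<and>
            (\<forall>ks\<in>set bs. length ks = r \<and> dissociated \<delta> (map a ks))"
    then obtain bs where bs: "length bs = m" "distinct (concat bs)" "set (concat bs) \<subseteq> {1..n}"
      "\<And>ks. ks \<in> set bs \<Longrightarrow> length ks = r \<and> dissociated \<delta> (map a ks)" by blast
    obtain \<epsilon> \<sigma> where \<epsilon>: "0 < \<epsilon>" "\<epsilon> \<le> \<sigma>" "\<tau> \<le> \<sigma>" "\<sigma> / \<epsilon> \<le> real n powr B"
      "\<And>ks. ks \<in> set bs \<Longrightarrow> dissociated \<epsilon> (map a ks)"
    proof (cases "\<delta> = 0")
      case True
      with ratio have "\<tau> = 0" by (auto simp: ext_ratio_def split: if_splits)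
      obtain \<epsilon> where "\<epsilon> > 0" "\<forall>us\<in>map a ` set bs. dissociated \<epsilon> us"
        using dissociated_zero_imp_pos_family[of "map a ` set bs"] bs(4) True by auto
      moreover have "1 \<le> real n powr B" using AB by (intro ge_one_powr_ge_zero) auto
      ultimately show ?thesis using \<open>\<tau> = 0\<close> by (intro that[of \<epsilon> \<epsilon>]) auto
    next
      case False
      with ratio \<delta> bs(4) show ?thesis
        by (intro that[of \<delta> \<tau>]) (auto simp: ext_ratio_def)
    qed
    define bound where "bound = exp (1 / 8) * (8 * (\<sigma> / \<epsilon>) * (3 / 4) ^ r)"
    have "measure F {x - \<tau> / 2 .. x + \<tau> / 2} \<le> bound" for x
    proof -
      have "measure F {x - \<tau> / 2 .. x + \<tau> / 2} \<le> measure F {x - \<sigma> / 2 .. x + \<sigma> / 2}"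
        using \<epsilon>(3) by (intro F.finite_measure_mono) auto
      also have "\<dots> \<le> bound"
        using concentration_le_of_dissociated_blocks[OF \<mu> p bs(2,3), where r = r and \<delta> = \<epsilon> and \<tau> = \<sigma>] bs \<epsilon> m
        by (simp add: F_def bound_def p_def)
      finally show ?thesis .
    qed
    then have "concentration F \<tau> \<le> bound"
      unfolding concentration_def by (intro cSUP_least) auto
    moreover have "bound < real n powr (- A)"
      unfolding bound_def using AB \<epsilon> r by (intro block_bound_less_powr[of _ _ B]) (auto simp: L_def)
    ultimately show False using conc by (simp add: F_def)
  qed
  have "\<exists>us. length us \<le> r \<and> 0 \<notin> set us \<and> card {k \<in> {1..n}. \<not> near_cube \<delta> us (a k)} \<le> m * r"
    by (rule disjE[OF many_blocks_or_few_exceptions[OF \<delta>(1) finite_atLeastAtMost]])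
       (erule notE[OF no_blocks], assumption)
  then obtain us where us: "length us \<le> r" "0 \<notin> set us"
    "card {k \<in> {1..n}. \<not> near_cube \<delta> us (a k)} \<le> m * r"
    by blast
  have "p * real (card {k \<in> {1..n}. \<not> near_cube \<delta> us (a k)}) \<le> p * real (m * r)"
    using us(3) p_bounds by (intro mult_left_mono) (auto simp del: of_nat_mult)
  also have "\<dots> = (p * real m) * real r" by simp
  also have "\<dots> \<le> 3 * (17 * L)" using m r p_bounds L by (intro mult_mono) auto
  finally show ?thesis
    using us r by (intro exI[of _ us]) (auto simp: p_def L_def)
qed

lemma cube_coefficients:
  "x \<in> cube us \<Longrightarrow> \<exists>m :: nat \<Rightarrow> int. (\<forall>j. m j \<in> {-1, 0, 1}) \<and> x = (\<Sum>j<length us. of_int (m j) * us ! j)"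
proof (induction us arbitrary: x)
  case Nil
  then show ?case by (intro exI[of _ "\<lambda>_. 0"]) auto
next
  case (Cons u us)
  then obtain c y where c: "c \<in> {-1, 0, 1}" and y: "y \<in> cube us" "x = c * u + y"
    unfolding cube.simps by blast
  from c obtain c' :: int where c': "c' \<in> {-1, 0, 1}" "c = of_int c'"
    by (auto intro: that[of "-1"] that[of 0] that[of 1])
  from Cons.IH[OF y(1)] obtain m :: "nat \<Rightarrow> int" where
    m: "\<And>j. m j \<in> {-1, 0, 1}" "y = (\<Sum>j<length us. of_int (m j) * us ! j)" by blast
  have "case_nat c' m j \<in> {-1, 0, 1}" for j
    using c' m(1) by (cases j) auto
  moreover have "x = (\<Sum>j<length (u # us). of_int (case_nat c' m j) * (u # us) ! j)"
    using y c' m(2) by (simp add: sum.lessThan_Suc_shift del: sum.lessThan_Suc)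
  ultimately show ?case by blast
qed

lemma cube_subset_K1_real:
  assumes "\<And>i. i < length us \<Longrightarrow> v (Suc i) = us ! i"
  shows "cube us \<subseteq> K1_real (length us) v"
proof
  fix x assume "x \<in> cube us"
  then obtain m :: "nat \<Rightarrow> int" where
    m: "\<And>j. m j \<in> {-1, 0, 1}" "x = (\<Sum>j<length us. of_int (m j) * us ! j)"
    using cube_coefficients by blast
  have "x = (\<Sum>j=1..length us. of_int (m (j - 1)) * v j)"
    unfolding m(2) One_nat_def sum.atLeast1_atMost_eq using assms by (intro sum.cong) auto
  with m(1) show "x \<in> K1_real (length us) v"
    unfolding K1_real_def by (intro CollectI exI[of _ "\<lambda>j. m (j - 1)"]) auto
qed

lemma near_cube_imp_closed_nbhd:
  assumes "near_cube \<delta> us x" "cube us \<subseteq> K"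
  shows "x \<in> closed_nbhd \<delta> K" "- x \<in> closed_nbhd \<delta> K"
proof -
  from assms obtain y where y: "y \<in> cube us" "\<bar>x - y\<bar> \<le> \<delta>" by (auto simp: near_cube_def)
  then have "y \<in> K" "- y \<in> K" using assms(2) uminus_in_cube by auto
  then have "infdist x K \<le> dist x y" "infdist (- x) K \<le> dist (- x) (- y)"
    by (auto intro: infdist_le)
  with y show "x \<in> closed_nbhd \<delta> K" "- x \<in> closed_nbhd \<delta> K"
    by (auto simp: closed_nbhd_def dist_real_def)
qed

section \<open>All coordinates together\<close>

text \<open>
  A vector outside the product has a coordinate outside the corresponding factor.  Each factor
  contains the \<open>\<delta> j\<close>-neighbourhood of the symmetric set \<open>cube (us j)\<close>, so a coordinate near this
  cube is harmless for both \<open>a k\<close> and \<open>- a k\<close>.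
\<close>

lemma M_star_le_sum_exceptions:
  assumes a: "\<And>k. k \<in> {1..n} \<Longrightarrow> a k \<in> rvec d"
    and K: "\<And>j. j \<in> {1..d} \<Longrightarrow> cube (us j) \<subseteq> K j"
  shows "M_star d n a (rvec d - PiE {1..d} (\<lambda>j. closed_nbhd (\<delta> j) (K j)))
    \<le> (\<Sum>j=1..d. 2 * real (card {k \<in> {1..n}. \<not> near_cube (\<delta> j) (us j) (a k j)}))"
proof -
  define C where "C = rvec d - PiE {1..d} (\<lambda>j. closed_nbhd (\<delta> j) (K j))"
  have return_le: "measure (return (rvec_borel d) x) C \<le> indicator C x" for x
    by (cases "C \<in> sets (rvec_borel d)") (auto simp: measure_return measure_notin_sets)
  have ind_le: "indicator C x \<le> (\<Sum>j=1..d. of_bool (x j \<notin> closed_nbhd (\<delta> j) (K j)) :: real)" for x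
  proof (cases "x \<in> C")
    case True
    then obtain j where "j \<in> {1..d}" "x j \<notin> closed_nbhd (\<delta> j) (K j)"
      by (auto simp: C_def rvec_def PiE_def Pi_def)
    then show ?thesis
      using member_le_sum[of j "{1..d}" "\<lambda>j. of_bool (x j \<notin> closed_nbhd (\<delta> j) (K j)) :: real"] True
      by (auto simp: indicator_def)
  qed (auto intro: sum_nonneg)
  have term_le: "indicator C (a k) + indicator C (rvec_uminus d (a k))
      \<le> (\<Sum>j=1..d. 2 * of_bool (\<not> near_cube (\<delta> j) (us j) (a k j)) :: real)" for k
  proof -
    have "indicator C (a k) + indicator C (rvec_uminus d (a k)) \<le>
      (\<Sum>j=1..d. of_bool (a k j \<notin> closed_nbhd (\<delta> j) (K j)) :: real) +
      (\<Sum>j=1..d. of_bool (rvec_uminus d (a k) j \<notin> closed_nbhd (\<delta> j) (K j)))"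
      by (intro add_mono ind_le)
    also have "\<dots> \<le> (\<Sum>j=1..d. of_bool (\<not> near_cube (\<delta> j) (us j) (a k j)) :: real) +
      (\<Sum>j=1..d. of_bool (\<not> near_cube (\<delta> j) (us j) (a k j)))"
      using near_cube_imp_closed_nbhd[OF _ K]
      by (intro add_mono sum_mono) (auto simp: rvec_uminus_def)
    finally show ?thesis by (simp flip: sum_distrib_left)
  qed
  have "M_star d n a C \<le> (\<Sum>k=1..n. \<Sum>j=1..d. 2 * of_bool (\<not> near_cube (\<delta> j) (us j) (a k j)))"
    unfolding M_star_def by (intro sum_mono order_trans[OF add_mono[OF return_le return_le] term_le])
  also have "\<dots> = (\<Sum>j=1..d. \<Sum>k=1..n. 2 * of_bool (\<not> near_cube (\<delta> j) (us j) (a k j)))"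
    by (rule sum.swap)
  also have "\<dots> = (\<Sum>j=1..d. 2 * real (card {k \<in> {1..n}. \<not> near_cube (\<delta> j) (us j) (a k j)}))"
    by (simp add: of_bool_def sum.If_cases Int_def flip: sum_distrib_left)
  finally show ?thesis unfolding C_def .
qed

text \<open>
  The generators of all coordinates in one sequence.  The \<open>i\<close>-th block of positions, between
  consecutive partial sums of \<open>r\<close>, holds the generators \<open>v i\<close> placed on the \<open>i\<close>-th axis.
\<close>

definition concat_axes ::
    "nat \<Rightarrow> (nat \<Rightarrow> nat) \<Rightarrow> (nat \<Rightarrow> nat \<Rightarrow> real) \<Rightarrow> nat \<Rightarrow> nat \<Rightarrow> real" where
  "concat_axes d r v s = (\<lambda>i\<in>{1..d}.
     if (\<Sum>j=1..i - 1. r j) < s \<and> s \<le> (\<Sum>j=1..i. r j) then v i (s - (\<Sum>j=1..i - 1. r j)) else 0)"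

lemma partial_sum_mono: "i \<le> i' \<Longrightarrow> (\<Sum>j=1..i. r j) \<le> (\<Sum>j=1..i'. r j)" for r :: "nat \<Rightarrow> nat"
  by (intro sum_mono2) auto

lemma partial_sum_step: "i \<ge> 1 \<Longrightarrow> (\<Sum>j=1..i. r j) = (\<Sum>j=1..i - 1. r j) + r i" for r :: "nat \<Rightarrow> nat"
  by (cases i) auto

lemma axis_block_unique:
  fixes r :: "nat \<Rightarrow> nat"
  assumes "(\<Sum>j=1..i - 1. r j) < s" "s \<le> (\<Sum>j=1..i. r j)"
    and "(\<Sum>j=1..k - 1. r j) < s" "s \<le> (\<Sum>j=1..k. r j)"
  shows "i = k"
proof (rule ccontr)
  assume "i \<noteq> k"
  then consider "i \<le> k - 1" | "k \<le> i - 1" by linarith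
  then show False
    using partial_sum_mono[of i "k - 1" r] partial_sum_mono[of k "i - 1" r] assms by cases auto
qed

lemma sum_concat_axes:
  fixes m :: "nat \<Rightarrow> int"
  assumes i: "i \<in> {1..d}"
  shows "(\<Sum>s=1..\<Sum>j=1..d. r j. of_int (m s) * concat_axes d r v s i)
    = (\<Sum>t=1..r i. of_int (m ((\<Sum>j=1..i - 1. r j) + t)) * v i t)"
proof -
  define off where "off = (\<Sum>j=1..i - 1. r j)"
  have off_eq: "(\<Sum>j=1..i. r j) = off + r i" using i partial_sum_step[of i r] by (simp add: off_def)
  have le: "off + r i \<le> (\<Sum>j=1..d. r j)" using i partial_sum_mono[of i d r] off_eq by simp
  have entry: "concat_axes d r v s i = (if off < s \<and> s \<le> off + r i then v i (s - off) else 0)" for s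
    by (simp only: concat_axes_def restrict_apply i if_True off_eq off_def[symmetric])
  have "(\<Sum>s=1..\<Sum>j=1..d. r j. of_int (m s) * concat_axes d r v s i)
      = (\<Sum>s=1 + off..r i + off. of_int (m s) * v i (s - off))"
  proof (rule sum.mono_neutral_cong_right)
    show "\<forall>s\<in>{1..\<Sum>j=1..d. r j} - {1 + off..r i + off}. of_int (m s) * concat_axes d r v s i = 0"
      by (auto simp: entry)
    show "of_int (m s) * concat_axes d r v s i = of_int (m s) * v i (s - off)"
      if "s \<in> {1 + off..r i + off}" for s
      using that by (auto simp: entry)
  qed (use le in auto)
  also have "\<dots> = (\<Sum>t=1..r i. of_int (m (off + t)) * v i t)"
    by (subst sum.shift_bounds_cl_nat_ivl) (simp add: add.commute)
  finally show ?thesis by (simp add: off_def)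
qed

text \<open>
  The blocks of positions are disjoint, so the coefficients of different coordinates can be chosen
  independently of each other.
\<close>

lemma PiE_K1_real_eq_K1:
  "PiE {1..d} (\<lambda>j. K1_real (r j) (v j)) = K1 d (\<Sum>j=1..d. r j) (concat_axes d r v)"
proof (intro subset_antisym subsetI)
  fix f assume f: "f \<in> PiE {1..d} (\<lambda>j. K1_real (r j) (v j))"
  have "\<forall>i\<in>{1..d}. \<exists>m :: nat \<Rightarrow> int. (\<forall>t\<in>{1..r i}. m t \<in> {-1, 0, 1}) \<and>
      f i = (\<Sum>t=1..r i. of_int (m t) * v i t)"
  proof
    fix i assume "i \<in> {1..d}"
    with f have "f i \<in> K1_real (r i) (v i)" by (rule PiE_mem)
    then show "\<exists>m :: nat \<Rightarrow> int. (\<forall>t\<in>{1..r i}. m t \<in> {-1, 0, 1}) \<and>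
        f i = (\<Sum>t=1..r i. of_int (m t) * v i t)"
      unfolding K1_real_def by blast
  qed
  then obtain M :: "nat \<Rightarrow> nat \<Rightarrow> int" where
    M: "\<And>i t. i \<in> {1..d} \<Longrightarrow> t \<in> {1..r i} \<Longrightarrow> M i t \<in> {-1, 0, 1}"
      "\<And>i. i \<in> {1..d} \<Longrightarrow> f i = (\<Sum>t=1..r i. of_int (M i t) * v i t)"
    by metis
  define Q where "Q s i \<longleftrightarrow> i \<in> {1..d} \<and> (\<Sum>j=1..i - 1. r j) < s \<and> s \<le> (\<Sum>j=1..i. r j)" for s i
  (* Each position takes the coefficient of the unique coordinate whose block contains it. *)
  define m where "m s = (if \<exists>i. Q s i then M (THE i. Q s i) (s - (\<Sum>j=1..(THE i. Q s i) - 1. r j)) else 0)"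
    for s
  have m_eq: "m s = M i (s - (\<Sum>j=1..i - 1. r j))" if "Q s i" for s i
  proof -
    have "(THE i. Q s i) = i"
      using that axis_block_unique unfolding Q_def by (intro the_equality) blast+
    with that show ?thesis by (auto simp: m_def)
  qed
  have "m s \<in> {-1, 0, 1}" for s
  proof (cases "\<exists>i. Q s i")
    case True
    then obtain i where "Q s i" by auto
    then have "i \<in> {1..d}" "s - (\<Sum>j=1..i - 1. r j) \<in> {1..r i}"
      using partial_sum_step[of i r] by (auto simp: Q_def)
    with M(1) m_eq[OF \<open>Q s i\<close>] show ?thesis by auto
  qed (simp add: m_def)
  moreover have "f = (\<lambda>i\<in>{1..d}. \<Sum>s=1..\<Sum>j=1..d. r j. of_int (m s) * concat_axes d r v s i)"
  proof (rule ext)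
    fix i
    show "f i = (\<lambda>i\<in>{1..d}. \<Sum>s=1..\<Sum>j=1..d. r j. of_int (m s) * concat_axes d r v s i) i"
    proof (cases "i \<in> {1..d}")
      case True
      have "m ((\<Sum>j=1..i - 1. r j) + t) = M i t" if "t \<in> {1..r i}" for t
      proof -
        have "Q ((\<Sum>j=1..i - 1. r j) + t) i"
          using True that partial_sum_step[of i r] by (auto simp: Q_def)
        from m_eq[OF this] show ?thesis by simp
      qed
      then have "f i = (\<Sum>t=1..r i. of_int (m ((\<Sum>j=1..i - 1. r j) + t)) * v i t)"
        unfolding M(2)[OF True] by (intro sum.cong refl) simp
      then show ?thesis
        using True sum_concat_axes[OF True, of m r v] by simp
    next
      case False
      then show ?thesis
        unfolding PiE_arb[OF f False] by (simp only: restrict_apply if_False)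
    qed
  qed
  ultimately show "f \<in> K1 d (\<Sum>j=1..d. r j) (concat_axes d r v)"
    unfolding K1_def by blast
next
  fix f assume "f \<in> K1 d (\<Sum>j=1..d. r j) (concat_axes d r v)"
  then obtain m :: "nat \<Rightarrow> int" where
    m: "\<And>s. s \<in> {1..\<Sum>j=1..d. r j} \<Longrightarrow> m s \<in> {-1, 0, 1}"
    and f: "f = (\<lambda>i\<in>{1..d}. \<Sum>s=1..\<Sum>j=1..d. r j. of_int (m s) * concat_axes d r v s i)"
    unfolding K1_def by blast
  show "f \<in> PiE {1..d} (\<lambda>j. K1_real (r j) (v j))"
  proof (rule PiE_I)
    fix i assume i: "i \<in> {1..d}"
    define off where "off = (\<Sum>j=1..i - 1. r j)"
    have "f i = (\<Sum>t=1..r i. of_int (m (off + t)) * v i t)"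
      unfolding f off_def using i sum_concat_axes[OF i, of m r v] by simp
    moreover have "m (off + t) \<in> {-1, 0, 1}" if "t \<in> {1..r i}" for t
    proof (rule m)
      have "off + r i \<le> (\<Sum>j=1..d. r j)"
        using i partial_sum_mono[of i d r] partial_sum_step[of i r] by (simp add: off_def)
      then show "off + t \<in> {1..\<Sum>j=1..d. r j}" using that by auto
    qed
    ultimately show "f i \<in> K1_real (r i) (v i)"
      unfolding K1_real_def by (intro CollectI exI[of _ "\<lambda>t. m (off + t)"]) blast
  qed (auto simp: f)
qed

lemma concat_axes_nonzero_iff:
  assumes "k \<in> {1..d}" "i \<in> {1..d}" "(\<Sum>j=1..k - 1. r j) < s" "s \<le> (\<Sum>j=1..k. r j)"
    and "\<And>t. t \<in> {1..r k} \<Longrightarrow> v k t \<noteq> 0"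
  shows "concat_axes d r v s i \<noteq> 0 \<longleftrightarrow> i = k"
proof
  assume "concat_axes d r v s i \<noteq> 0"
  then show "i = k"
    using assms axis_block_unique[of r i s k] by (auto simp: concat_axes_def split: if_splits)
next
  assume "i = k"
  moreover have "s - (\<Sum>j=1..k - 1. r j) \<in> {1..r k}"
    using assms partial_sum_step[of k r] by auto
  ultimately show "concat_axes d r v s i \<noteq> 0"
    using assms by (auto simp: concat_axes_def)
qed


theorem theorem4:
  "\<exists>c::real. c > 0 \<and>
    (\<forall>(d::nat) (n::nat) (\<mu>::real measure) (a::nat \<Rightarrow> nat \<Rightarrow> real) (A::real) (B::real)
      (\<tau>::nat \<Rightarrow> real) (\<delta>::nat \<Rightarrow> real).
      d \<ge> 1 \<and> n \<ge> 1 \<and>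
      real_distribution \<mu> \<and> sym_tail \<mu> 1 > 0 \<and>
      (\<forall>k\<in>{1..n}. a k \<in> rvec d) \<and>
      (\<exists>k\<in>{1..n}. \<exists>j\<in>{1..d}. a k j \<noteq> 0) \<and>
      A > 0 \<and> B > 0 \<and>
      (\<forall>j\<in>{1..d}. \<tau> j \<ge> \<delta> j \<and> \<delta> j \<ge> 0 \<and>
         ext_ratio (\<tau> j) (\<delta> j) \<le> ereal (real n powr B) \<and>
         concentration (coord_law d n \<mu> a j) (\<tau> j) \<ge> real n powr (- A))
      \<longrightarrow>
      (\<exists>(r::nat \<Rightarrow> nat) (v::nat \<Rightarrow> nat \<Rightarrow> real).
         (\<forall>j\<in>{1..d}. r j \<ge> 1 \<and> v j \<in> rvec (r j)) \<and>
         real (\<Sum>j=1..d. r j) \<le> c * real d * ((A + B) * ln (real n) + 1) \<and>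
         sym_tail \<mu> 1 *
           M_star d n a (rvec d - PiE {1..d} (\<lambda>j. closed_nbhd (\<delta> j) (K1_real (r j) (v j))))
           \<le> c * real d * ((A + B) * ln (real n) + 1) ^ 3 \<and>
         (\<exists>u::nat \<Rightarrow> nat \<Rightarrow> real.
            (\<forall>s\<in>{1..\<Sum>j=1..d. r j}. u s \<in> rvec d) \<and>
            PiE {1..d} (\<lambda>j. K1_real (r j) (v j)) = K1 d (\<Sum>j=1..d. r j) u \<and>
            (\<forall>k\<in>{1..d}. \<forall>s. (\<Sum>j=1..k - 1. r j) < s \<and> s \<le> (\<Sum>j=1..k. r j) \<longrightarrow>
               (\<forall>i\<in>{1..d}. u s i \<noteq> 0 \<longleftrightarrow> i = k) \<and>
               u s k = v k (s - (\<Sum>j=1..k - 1. r j))))))"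
proof (intro exI[of _ 102] conjI allI impI; (elim conjE)?)
  show "(102 :: real) > 0" by simp
next
  fix d n :: nat and \<mu> :: "real measure" and a :: "nat \<Rightarrow> nat \<Rightarrow> real" and A B :: real
    and \<tau> \<delta> :: "nat \<Rightarrow> real"
  assume n: "n \<ge> 1" and \<mu>: "real_distribution \<mu>" and p: "sym_tail \<mu> 1 > 0"
    and a: "\<forall>k\<in>{1..n}. a k \<in> rvec d" and AB: "A > 0" "B > 0"
    and H: "\<forall>j\<in>{1..d}. \<tau> j \<ge> \<delta> j \<and> \<delta> j \<ge> 0 \<and>
         ext_ratio (\<tau> j) (\<delta> j) \<le> ereal (real n powr B) \<and>
         concentration (coord_law d n \<mu> a j) (\<tau> j) \<ge> real n powr (- A)"
  define p where "p = sym_tail \<mu> 1"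
  define L where "L = (A + B) * ln (real n) + 1"
  have L: "L \<ge> 1" using n AB by (simp add: L_def)
  have law: "coord_law d n \<mu> a j = distr (iid_space n \<mu>) borel (\<lambda>x. \<Sum>k=1..n. x k * a k j)"
    if "j \<in> {1..d}" for j
    using that by (simp add: coord_law_def weighted_sum_def)
  have "\<forall>j\<in>{1..d}. \<exists>us. real (length us) \<le> 17 * L \<and> 0 \<notin> set us \<and>
      p * real (card {k \<in> {1..n}. \<not> near_cube (\<delta> j) us (a k j)}) \<le> 51 * L"
    unfolding p_def L_def
  proof
    fix j assume "j \<in> {1..d}"
    with H law show "\<exists>us. real (length us) \<le> 17 * ((A + B) * ln (real n) + 1) \<and> 0 \<notin> set us \<and>
        sym_tail \<mu> 1 * real (card {k \<in> {1..n}. \<not> near_cube (\<delta> j) us (a k j)})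
          \<le> 51 * ((A + B) * ln (real n) + 1)"
      by (intro concentrated_imp_few_exceptions[OF \<mu> p n AB, where \<tau> = "\<tau> j"]) auto
  qed
  from bchoice[OF this] obtain us where us: "\<And>j. j \<in> {1..d} \<Longrightarrow> real (length (us j)) \<le> 17 * L"
    "\<And>j. j \<in> {1..d} \<Longrightarrow> 0 \<notin> set (us j)"
    "\<And>j. j \<in> {1..d} \<Longrightarrow> p * real (card {k \<in> {1..n}. \<not> near_cube (\<delta> j) (us j) (a k j)}) \<le> 51 * L"
    by blast
  (* A dummy generator keeps the number of generators positive when the list is empty. *)
  define ws where "ws j = 1 # us j" for j
  define r where "r j = length (ws j)" for j
  define v where "v j = (\<lambda>i\<in>{1..r j}. ws j ! (i - 1))" for j
  define R where "R = (\<Sum>j=1..d. r j)"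
  have v_nonzero: "v j t \<noteq> 0" if "j \<in> {1..d}" "t \<in> {1..r j}" for j t
  proof -
    have "ws j ! (t - 1) \<in> set (ws j)" using that by (intro nth_mem) (auto simp: r_def)
    then show ?thesis using that us(2)[of j] by (auto simp: v_def ws_def)
  qed
  have K: "cube (us j) \<subseteq> K1_real (r j) (v j)" for j
  proof -
    have "cube (us j) \<subseteq> cube (ws j)" unfolding ws_def by (intro subsetI cube_Cons_tail)
    also have "\<dots> \<subseteq> K1_real (length (ws j)) (v j)"
      by (rule cube_subset_K1_real) (simp add: v_def r_def)
    finally show ?thesis by (simp add: r_def)
  qed
  have R_le: "real R \<le> 102 * real d * L"
  proof -
    have "real R = (\<Sum>j=1..d. real (r j))" by (simp add: R_def)
    also have "\<dots> \<le> (\<Sum>j=1..d. 102 * L)"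
    proof (rule sum_mono)
      fix j assume "j \<in> {1..d}"
      from us(1)[OF this] L show "real (r j) \<le> 102 * L" by (simp add: r_def ws_def)
    qed
    finally show ?thesis by simp
  qed
  have M_le: "p * M_star d n a (rvec d - PiE {1..d} (\<lambda>j. closed_nbhd (\<delta> j) (K1_real (r j) (v j))))
      \<le> 102 * real d * L ^ 3"
  proof -
    have "p * M_star d n a (rvec d - PiE {1..d} (\<lambda>j. closed_nbhd (\<delta> j) (K1_real (r j) (v j)))) \<le>
        p * (\<Sum>j=1..d. 2 * real (card {k \<in> {1..n}. \<not> near_cube (\<delta> j) (us j) (a k j)}))"
      using p a K by (intro mult_left_mono M_star_le_sum_exceptions) (auto simp: p_def)
    also have "\<dots> = (\<Sum>j=1..d. 2 * (p * real (card {k \<in> {1..n}. \<not> near_cube (\<delta> j) (us j) (a k j)})))"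
      by (simp add: sum_distrib_left mult_ac)
    also have "\<dots> \<le> (\<Sum>j=1..d. 2 * (51 * L))"
      using us(3) by (intro sum_mono mult_left_mono) auto
    also have "\<dots> = 102 * real d * L" by simp
    also have "\<dots> \<le> 102 * real d * L ^ 3"
      using L self_le_power[of L 3] by (intro mult_left_mono) auto
    finally show ?thesis .
  qed
  define u where "u = concat_axes d r v"
  show "\<exists>r v. (\<forall>j\<in>{1..d}. r j \<ge> 1 \<and> v j \<in> rvec (r j)) \<and>
         real (\<Sum>j=1..d. r j) \<le> 102 * real d * ((A + B) * ln (real n) + 1) \<and>
         sym_tail \<mu> 1 *
           M_star d n a (rvec d - PiE {1..d} (\<lambda>j. closed_nbhd (\<delta> j) (K1_real (r j) (v j))))
           \<le> 102 * real d * ((A + B) * ln (real n) + 1) ^ 3 \<and>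
         (\<exists>u. (\<forall>s\<in>{1..\<Sum>j=1..d. r j}. u s \<in> rvec d) \<and>
            PiE {1..d} (\<lambda>j. K1_real (r j) (v j)) = K1 d (\<Sum>j=1..d. r j) u \<and>
            (\<forall>k\<in>{1..d}. \<forall>s. (\<Sum>j=1..k - 1. r j) < s \<and> s \<le> (\<Sum>j=1..k. r j) \<longrightarrow>
               (\<forall>i\<in>{1..d}. u s i \<noteq> 0 \<longleftrightarrow> i = k) \<and>
               u s k = v k (s - (\<Sum>j=1..k - 1. r j))))"
  proof (rule exI[of _ r], rule exI[of _ v], intro exI[of _ u] conjI ballI allI impI)
    show "r j \<ge> 1" "v j \<in> rvec (r j)" for j
      by (auto simp: r_def ws_def v_def rvec_def)
    show "u s \<in> rvec d" for s
      by (auto simp: u_def concat_axes_def rvec_def)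
    show "PiE {1..d} (\<lambda>j. K1_real (r j) (v j)) = K1 d (\<Sum>j=1..d. r j) u"
      unfolding u_def by (rule PiE_K1_real_eq_K1)
    fix k s assume k: "k \<in> {1..d}" and s: "(\<Sum>j=1..k - 1. r j) < s \<and> s \<le> (\<Sum>j=1..k. r j)"
    show "u s i \<noteq> 0 \<longleftrightarrow> i = k" if "i \<in> {1..d}" for i
      unfolding u_def using k s that v_nonzero by (intro concat_axes_nonzero_iff) auto
    show "u s k = v k (s - (\<Sum>j=1..k - 1. r j))"
      using k s by (simp add: u_def concat_axes_def)
  qed (use R_le M_le in \<open>simp_all add: R_def p_def L_def\<close>)
qed

end
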